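(* Let $0<\epsilon\le\frac16$ and set $\beta=\epsilon$. The algorithm described below is $(1+6\epsilon)$-speed $\frac{2}{\epsilon^2}$-competitive for total flow time plus energy in fractional broadcast scheduling; i.e., on every request sequence its total flow time plus energy (with the power accounting below) is at most $\frac{2}{\epsilon^2}$ times the optimal offline total flow time plus energy.
   Context: Fractional broadcast scheduling with speed scaling: a server stores pages, page $p$ having size $\sigma_p$; requests $J_{p,i}$ (the $i$-th request for page $p$) arrive online at times $a_{p,i}$. At each time $t$ the server broadcasts pages at various rates; a request $J_{p,i}$ is satisfied once the total amount of page $p$ broadcast after $a_{p,i}$ reaches $\sigma_p$; its satisfaction time is $f_{p,i}$. Total flow time is $\sum_{p,i}(f_{p,i}-a_{p,i})$; energy is $\int_0^\infty P(s(t))dt$ where $s(t)$ is the total speed and $P$ is a power function that is defined, continuous, differentiable, $P(0)=0$, strictly increasing, strictly convex and unbounded; the objective is flow time plus energy. Let $Q=P^{-1}$. The algorithm: let $N_a(t)$ be the set of requests unsatisfied by the algorithm at time $t$. It broadcasts at total rate $(1+6\epsilon)Q(|N_a(t)|)$ and is charged power $P(Q(|N_a(t)|))=|N_a(t)|$ (this is the $(1+6\epsilon)$ resource augmentation; the optimal schedule is charged $P$ of its actual speed). The rate is split as follows: each of the $\lfloor\beta|N_a(t)|\rfloor$ requests of $N_a(t)$ with latest arrival times contributes rate $x_{p,i}(t)=\frac{(1+6\epsilon)Q(|N_a(t)|)}{\beta|N_a(t)|}$ to its page $p$, and if $\beta|N_a(t)|$ is not an integer, the next latest-arriving request contributes rate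 $(\beta|N_a(t)|-\lfloor\beta|N_a(t)|\rfloor)\frac{(1+6\epsilon)Q(|N_a(t)|)}{\beta|N_a(t)|}$; all other requests contribute $0$. Page $p$ is broadcast at rate equal to the sum of contributions of requests for $p$. *)

theory Defs
  imports "HOL-Analysis.Analysis"
begin

definition strictly_convex_on :: "real set \<Rightarrow> (real \<Rightarrow> real) \<Rightarrow> bool" where
  "strictly_convex_on S f \<longleftrightarrow> convex S \<and>
     (\<forall>x\<in>S. \<forall>y\<in>S. \<forall>u. x \<noteq> y \<and> 0 < u \<and> u < 1 \<longrightarrow>
        f ((1 - u) * x + u * y) < (1 - u) * f x + u * f y)"

text \<open>Speeds are nonnegative, so only the values of \<open>P\<close> on \<open>{0..}\<close> matter; differentiability
  at \<open>0\<close> is one-sided.\<close>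

definition power_function :: "(real \<Rightarrow> real) \<Rightarrow> bool" where
  "power_function P \<longleftrightarrow>
     continuous_on {0..} P \<and> P differentiable_on {0..} \<and> P 0 = 0 \<and>
     strict_mono_on {0..} P \<and> strictly_convex_on {0..} P \<and>
     (\<forall>B. \<exists>x\<ge>0. B < P x)"

definition speed_of_power :: "(real \<Rightarrow> real) \<Rightarrow> real \<Rightarrow> real" where
  "speed_of_power P = the_inv_into {0..} P"

text \<open>A request is a pair of a page and an arrival time, and is referred to by its position in
  \<open>requests\<close>; the \<open>i\<close>-th request for \<open>p\<close> is the \<open>i\<close>-th entry with first component \<open>p\<close>. The list
  is in order of arrival, and among simultaneous arrivals the later entry counts as the
  later-arriving one, so the order of the list fixes an arbitrary tie-breaking rule.\<close>

record 'p instance_data =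
  pages :: "'p set"
  page_size :: "'p \<Rightarrow> real"
  requests :: "('p \<times> real) list"

definition broadcast_instance :: "'p instance_data \<Rightarrow> bool" where
  "broadcast_instance I \<longleftrightarrow>
     finite (pages I) \<and> (\<forall>p\<in>pages I. 0 < page_size I p) \<and>
     fst ` set (requests I) \<subseteq> pages I \<and>
     (\<forall>x\<in>set (requests I). 0 \<le> snd x) \<and> sorted (map snd (requests I))"

abbreviation req_page :: "'p instance_data \<Rightarrow> nat \<Rightarrow> 'p" where
  "req_page I j \<equiv> fst (requests I ! j)"

abbreviation arrival :: "'p instance_data \<Rightarrow> nat \<Rightarrow> real" where
  "arrival I j \<equiv> snd (requests I ! j)"

text \<open>In a schedule \<open>r\<close>, \<open>r p t\<close> is the rate at which page \<open>p\<close> is broadcast at time \<open>t\<close>.\<close>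

definition schedule :: "'p instance_data \<Rightarrow> ('p \<Rightarrow> real \<Rightarrow> real) \<Rightarrow> bool" where
  "schedule I r \<longleftrightarrow> (\<forall>p\<in>pages I. r p \<in> borel_measurable borel \<and> (\<forall>t. 0 \<le> r p t))"

definition amount_broadcast :: "('p \<Rightarrow> real \<Rightarrow> real) \<Rightarrow> 'p \<Rightarrow> real \<Rightarrow> real \<Rightarrow> ennreal" where
  "amount_broadcast r p a t = (\<integral>\<^sup>+ x\<in>{a..t}. ennreal (r p x) \<partial>lborel)"

definition satisfied_by :: "'p instance_data \<Rightarrow> ('p \<Rightarrow> real \<Rightarrow> real) \<Rightarrow> nat \<Rightarrow> real \<Rightarrow> bool" where
  "satisfied_by I r j t \<longleftrightarrow> arrival I j \<le> t \<and>
     ennreal (page_size I (req_page I j)) \<le> amount_broadcast r (req_page I j) (arrival I j) t"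

text \<open>The satisfaction time is \<open>\<infinity>\<close> for a request that is never satisfied.\<close>

definition satisfaction_time :: "'p instance_data \<Rightarrow> ('p \<Rightarrow> real \<Rightarrow> real) \<Rightarrow> nat \<Rightarrow> ennreal" where
  "satisfaction_time I r j = (INF t\<in>{t. satisfied_by I r j t}. ennreal t)"

definition total_flow_time :: "'p instance_data \<Rightarrow> ('p \<Rightarrow> real \<Rightarrow> real) \<Rightarrow> ennreal" where
  "total_flow_time I r =
     (\<Sum>j<length (requests I). satisfaction_time I r j - ennreal (arrival I j))"

definition energy :: "(real \<Rightarrow> real) \<Rightarrow> 'p instance_data \<Rightarrow> ('p \<Rightarrow> real \<Rightarrow> real) \<Rightarrow> ennreal" where
  "energy P I r = (\<integral>\<^sup>+ t\<in>{0..}. ennreal (P (\<Sum>p\<in>pages I. r p t)) \<partial>lborel)"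

definition opt_cost :: "(real \<Rightarrow> real) \<Rightarrow> 'p instance_data \<Rightarrow> ennreal" where
  "opt_cost P I = (INF r\<in>{r. schedule I r}. total_flow_time I r + energy P I r)"

definition unsatisfied :: "'p instance_data \<Rightarrow> ('p \<Rightarrow> real \<Rightarrow> real) \<Rightarrow> real \<Rightarrow> nat set" where
  "unsatisfied I r t = {j. j < length (requests I) \<and> arrival I j \<le> t \<and> \<not> satisfied_by I r j t}"

text \<open>The rate contributed by request \<open>j \<in> N\<close> when \<open>N\<close> is the set of unsatisfied requests, with
  speed factor \<open>\<alpha>\<close>. The number \<open>later\<close> of unsatisfied requests arriving after \<open>j\<close> determines
  whether \<open>j\<close> is among the \<open>\<lfloor>\<beta> * card N\<rfloor>\<close> latest ones, is the next one, or neither. If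
  \<open>\<beta> * card N\<close> is an integer, the contribution of the next one is \<open>0\<close>.\<close>

definition contribution ::
  "(real \<Rightarrow> real) \<Rightarrow> real \<Rightarrow> real \<Rightarrow> nat set \<Rightarrow> nat \<Rightarrow> real" where
  "contribution P \<alpha> \<beta> N j =
     (let n = real (card N);
          later = int (card {k \<in> N. j < k});
          x = \<alpha> * speed_of_power P n / (\<beta> * n)
      in if later < \<lfloor>\<beta> * n\<rfloor> then x
         else if later = \<lfloor>\<beta> * n\<rfloor> then (\<beta> * n - of_int \<lfloor>\<beta> * n\<rfloor>) * x
         else 0)"

definition algorithm_schedule ::
  "(real \<Rightarrow> real) \<Rightarrow> real \<Rightarrow> real \<Rightarrow> 'p instance_data \<Rightarrow> ('p \<Rightarrow> real \<Rightarrow> real) \<Rightarrow> bool" where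
  "algorithm_schedule P \<alpha> \<beta> I r \<longleftrightarrow> schedule I r \<and>
     (\<forall>t\<ge>0. \<forall>p\<in>pages I.
        r p t = (\<Sum>j\<in>{j \<in> unsatisfied I r t. req_page I j = p}.
                   contribution P \<alpha> \<beta> (unsatisfied I r t) j))"

text \<open>The algorithm is charged for the speed without the augmentation factor \<open>\<alpha>\<close>.\<close>

definition algorithm_energy ::
  "(real \<Rightarrow> real) \<Rightarrow> 'p instance_data \<Rightarrow> ('p \<Rightarrow> real \<Rightarrow> real) \<Rightarrow> ennreal" where
  "algorithm_energy P I r =
     (\<integral>\<^sup>+ t\<in>{0..}. ennreal (P (speed_of_power P (real (card (unsatisfied I r t))))) \<partial>lborel)"

end

theory Submission
  imports Defs
begin

text \<open>
  Let \<open>A(t)\<close> and \<open>B(t)\<close> be the requests left unsatisfied at time \<open>t\<close> by the algorithm and by an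
  arbitrary schedule \<open>y\<close>, let \<open>n = card A(t)\<close>, let \<open>x\<^sub>j(t)\<close> be the rate contributed by \<open>j\<close>, and let
  \<open>h\<^sub>j(t) = k / Q(k)\<close> where \<open>k\<close> is the number of requests in \<open>A(t)\<close> arriving no later than \<open>j\<close>.
  Only requests with \<open>k \<ge> (1 - \<epsilon>) n\<close> contribute, so
  \<open>(1 - \<epsilon>) (1 + 6 \<epsilon>) (n - card B(t) / \<epsilon>) \<le> (\<Sum>j\<in>A(t)-B(t). h\<^sub>j(t) x\<^sub>j(t))\<close>.
  A request in \<open>A(t) - B(t)\<close> has had its whole page broadcast by \<open>y\<close> since its arrival. Since \<open>h\<^sub>j\<close> is
  nonincreasing in time (\<open>k / Q(k)\<close> increases with \<open>k\<close> because \<open>P\<close> is convex), exchanging the order of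
  integration charges \<open>h\<^sub>j(t) x\<^sub>j(t)\<close> to the earlier times \<open>u\<close> at which \<open>y\<close> broadcast the page. The
  future contributions of all requests for a page that are unsatisfied at \<open>u\<close> sum to at most its
  size, so the charge at \<open>u\<close> is at most \<open>n s / Q(n) \<le> n + P(s)\<close>, where \<open>s\<close> is the speed of \<open>y\<close>. As
  \<open>(1 - \<epsilon>) (1 + 6 \<epsilon>) \<ge> 1 + 4 \<epsilon>\<close>, cancelling the integral of \<open>n\<close> over a bounded time interval, where it
  is finite, bounds it by the cost of \<open>y\<close>. This is the usual amortized argument in integrated form;
  it needs no derivative of a potential, so \<open>y\<close> may be merely measurable.
\<close>


section \<open>Power functions\<close>

text \<open>Unboundedness brackets \<open>y\<close> from above, so the intermediate value theorem
  makes \<open>P\<close> map \<open>{0..}\<close> onto \<open>{0..}\<close>. Hence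
  \<open>the_inv_into\<close> takes a genuine value at every nonnegative \<open>y\<close>.\<close>

lemma power_speed:
  assumes P: "power_function P" and y: "0 \<le> y"
  shows "0 \<le> speed_of_power P y" "P (speed_of_power P y) = y"
proof -
  have inj: "inj_on P {0..}"
    using P by (auto simp: power_function_def strict_mono_on_imp_inj_on)
  obtain x where x: "0 \<le> x" "y < P x"
    using P by (auto simp: power_function_def)
  have "continuous_on {0..x} P"
    using P by (auto simp: power_function_def intro: continuous_on_subset)
  with IVT'[of P 0 y x] x y P obtain z where "0 \<le> z" "P z = y"
    by (auto simp: power_function_def)
  then have im: "y \<in> P ` {0..}" by auto
  show "0 \<le> speed_of_power P y"
    using the_inv_into_into[OF inj im order_refl] by (simp add: speed_of_power_def)
  show "P (speed_of_power P y) = y"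
    unfolding speed_of_power_def by (rule f_the_inv_into_f[OF inj im])
qed

lemma power_strict_mono:
  assumes "power_function P" "0 \<le> x" "x < y"
  shows "P x < P y"
  using assms by (auto simp: power_function_def strict_mono_on_def)

lemma power_nonneg:
  assumes "power_function P" "0 \<le> x"
  shows "0 \<le> P x"
  using assms power_strict_mono[of P 0 x] by (cases "x = 0") (auto simp: power_function_def)

lemma speed_mono:
  assumes P: "power_function P" and "0 \<le> x" "x \<le> y"
  shows "speed_of_power P x \<le> speed_of_power P y"
  using power_strict_mono[OF P, of "speed_of_power P y" "speed_of_power P x"]
    power_speed[OF P] assms by (metis linorder_not_le order_trans)

lemma speed_pos:
  assumes P: "power_function P" and "0 < x"
  shows "0 < speed_of_power P x"
  using power_speed[OF P, of x] assms by (cases "speed_of_power P x = 0") (auto simp: power_function_def)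

text \<open>Convexity on the chord from the origin, where \<open>P 0 = 0\<close>: the slope
  \<open>P x / x\<close> is nondecreasing. The inequality is stated free of division.\<close>

lemma power_star_shaped:
  assumes P: "power_function P" and "0 < x" "x \<le> y"
  shows "P x * y \<le> P y * x"
proof (cases "x = y")
  case False
  have strict: "P ((1 - u) * a + u * b) < (1 - u) * P a + u * P b"
    if "0 \<le> a" "0 \<le> b" "a \<noteq> b" "0 < u" "u < 1" for a b u
    using P that by (simp add: power_function_def strictly_convex_on_def)
  have "P ((1 - x / y) * 0 + x / y * y) < (1 - x / y) * P 0 + x / y * P y"
    using assms False by (intro strict) auto
  then have "P x < x / y * P y"
    using assms P by (simp add: power_function_def)
  then show ?thesis
    using assms False by (simp add: field_simps)
qed simp

lemma power_measurable:
  assumes P: "power_function P" and s: "s \<in> borel_measurable M" "\<And>t. 0 \<le> s t"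
  shows "(\<lambda>t. P (s t)) \<in> borel_measurable M"
proof -
  \<comment> \<open>\<open>P\<close> is controlled on \<open>{0..}\<close> only, so it is replaced
    on the negative axis by its value at 0.\<close>
  have "continuous_on UNIV (\<lambda>x. P (max 0 x))"
  proof (rule continuous_on_compose2[where g = P and t = "{0..}"])
    show "continuous_on {0..} P" using P by (simp add: power_function_def)
    show "continuous_on UNIV (\<lambda>x::real. max 0 x)" by (intro continuous_intros)
  qed auto
  then have "(\<lambda>x. P (max 0 x)) \<in> borel_measurable borel"
    by (rule borel_measurable_continuous_onI)
  from measurable_compose[OF s(1) this] show ?thesis
    using s(2) by (simp add: max_def)
qed

text \<open>With \<open>s = speed_of_power P k\<close> this is the chord slope
  \<open>P s / s\<close>, the reciprocal of the chord slope of the inverse of \<open>P\<close> at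
  \<open>k\<close>. At \<open>k = 0\<close> its value is 0.\<close>

definition inverse_slope :: "(real \<Rightarrow> real) \<Rightarrow> nat \<Rightarrow> real" where
  "inverse_slope P k = real k / speed_of_power P (real k)"

lemma inverse_slope_nonneg:
  "power_function P \<Longrightarrow> 0 \<le> inverse_slope P k"
  by (simp add: inverse_slope_def power_speed)

lemma inverse_slope_mono:
  assumes P: "power_function P" and "k \<le> l"
  shows "inverse_slope P k \<le> inverse_slope P l"
proof (cases "k = 0")
  case True
  then show ?thesis
    using inverse_slope_nonneg[OF P, of l] by (simp add: inverse_slope_def)
next
  case False
  then have pos: "0 < speed_of_power P (real k)" "0 < speed_of_power P (real l)"
    using assms speed_pos[OF P] by auto
  have "real k * speed_of_power P (real l) \<le> real l * speed_of_power P (real k)"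
    using power_star_shaped[OF P pos(1) speed_mono[OF P]] assms power_speed[OF P] by auto
  then show ?thesis
    using pos by (simp add: inverse_slope_def field_simps)
qed

text \<open>One of the two summands alone suffices. Up to the speed \<open>?q\<close> with power
  \<open>n\<close>, the factor \<open>s / ?q\<close> is at most 1; beyond it, the chord slope of
  \<open>P\<close> at \<open>?q\<close> is at most that at \<open>s\<close>.\<close>

lemma inverse_slope_times_speed_le:
  assumes P: "power_function P" and s: "0 \<le> s"
  shows "inverse_slope P n * s \<le> real n + P s"
proof (cases "n = 0")
  case True
  then show ?thesis using power_nonneg[OF P s] by (simp add: inverse_slope_def)
next
  case False
  let ?q = "speed_of_power P (real n)"
  have q: "0 < ?q" "P ?q = n" using False speed_pos[OF P] power_speed[OF P] by auto
  show ?thesis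
  proof (cases "s \<le> ?q")
    case True
    then have "real n * s \<le> real n * ?q" by (intro mult_left_mono) auto
    then have "real n * s / ?q \<le> real n" using q by (simp add: field_simps)
    then show ?thesis using power_nonneg[OF P s] by (simp add: inverse_slope_def)
  next
    case False
    then have "real n * s \<le> P s * ?q" using power_star_shaped[OF P q(1), of s] q by simp
    then have "real n * s / ?q \<le> P s" using q by (simp add: field_simps)
    then show ?thesis by (simp add: inverse_slope_def)
  qed
qed

section \<open>Flow time as an integral\<close>

lemma amount_broadcast_mono:
  "s \<le> t \<Longrightarrow> amount_broadcast r p a s \<le> amount_broadcast r p a t"
  unfolding amount_broadcast_def by (intro nn_integral_mono) (auto simp: indicator_def)

lemma satisfied_by_mono:
  "satisfied_by I r j s \<Longrightarrow> s \<le> t \<Longrightarrow> satisfied_by I r j t"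
  unfolding satisfied_by_def by (meson amount_broadcast_mono order_trans)

lemma unsatisfied_antimono:
  "j \<in> unsatisfied I r t \<Longrightarrow> arrival I j \<le> s \<Longrightarrow> s \<le> t \<Longrightarrow> j \<in> unsatisfied I r s"
  by (auto simp: unsatisfied_def intro: satisfied_by_mono)

lemma finite_unsatisfied [simp]: "finite (unsatisfied I r t)"
  by (simp add: unsatisfied_def)

lemma card_unsatisfied_le: "card (unsatisfied I r t) \<le> length (requests I)"
  using card_mono[of "{..<length (requests I)}" "unsatisfied I r t"]
  by (auto simp: unsatisfied_def)

lemma upward_closed_borel:
  fixes S :: "real set"
  assumes "\<And>x y. x \<in> S \<Longrightarrow> x \<le> y \<Longrightarrow> y \<in> S"
  shows "S \<in> sets borel"
proof -
  have "mono (indicator S :: real \<Rightarrow> real)"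
    using assms by (auto simp: mono_def indicator_def)
  then have "(indicator S :: real \<Rightarrow> real) \<in> borel_measurable borel"
    by (rule borel_measurable_mono)
  then show ?thesis by (simp add: borel_measurable_indicator_iff)
qed

lemma satisfied_by_borel: "{t. satisfied_by I r j t} \<in> sets borel"
  by (rule upward_closed_borel) (auto intro: satisfied_by_mono)

lemma unsatisfied_borel: "{t. j \<in> unsatisfied I r t} \<in> sets borel"
proof (cases "j < length (requests I)")
  case True
  then have "{t. j \<in> unsatisfied I r t} = {arrival I j..} - {t. satisfied_by I r j t}"
    by (auto simp: unsatisfied_def)
  then show ?thesis using satisfied_by_borel[of I r j] by simp
qed (simp add: unsatisfied_def)

lemma unsatisfied_set_borel: "{t. unsatisfied I r t = N} \<in> sets borel"
proof (cases "N \<subseteq> {..<length (requests I)}")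
  case True
  have "{t. unsatisfied I r t = N} =
    (\<Inter>j\<in>{..<length (requests I)}. if j \<in> N then {t. j \<in> unsatisfied I r t} else - {t. j \<in> unsatisfied I r t}) "
    using True by (auto simp: unsatisfied_def split: if_splits)
  also have "\<dots> \<in> sets borel"
    by (intro sets.countable_INT'') (auto intro: unsatisfied_borel borel_comp)
  finally show ?thesis .
next
  case False
  then have "{t. unsatisfied I r t = N} = {}" by (auto simp: unsatisfied_def)
  then show ?thesis by simp
qed

text \<open>The values lie in a finite power set, so Borel level sets suffice. Every quantity that
  depends on time only through the unsatisfied set then becomes measurable.\<close>

lemma unsatisfied_measurable [measurable]:
  "unsatisfied I r \<in> borel \<rightarrow>\<^sub>M count_space (Pow {..<length (requests I)})"
proof (rule measurable_count_space_eq2[THEN iffD2])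
  have "unsatisfied I r -` {N} \<inter> space borel \<in> sets borel" for N
    using unsatisfied_set_borel[of I r N] by (simp add: vimage_def)
  then show "unsatisfied I r \<in> space borel \<rightarrow> Pow {..<length (requests I)} \<and>
     (\<forall>a\<in>Pow {..<length (requests I)}. unsatisfied I r -` {a} \<inter> space borel \<in> sets borel)"
    by (auto simp: unsatisfied_def)
qed auto

lemma borel_of_unsatisfied:
  fixes f :: "nat set \<Rightarrow> 'a::topological_space"
  shows "(\<lambda>t. f (unsatisfied I r t)) \<in> borel_measurable borel"
  by (rule measurable_compose[OF unsatisfied_measurable]) simp

text \<open>The times at which \<open>j\<close> is unsatisfied form an interval from its arrival to
  the infimum of its satisfied times. Whether that infimum is attained changes only a null set. A
  request never satisfied gives a half-line of infinite measure.\<close>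

lemma flow_time_eq_emeasure:
  assumes a: "0 \<le> arrival I j" and j: "j < length (requests I)"
  shows "satisfaction_time I r j - ennreal (arrival I j) =
    emeasure lborel {t. j \<in> unsatisfied I r t}"
proof (cases "\<exists>t. satisfied_by I r j t")
  case False
  have "emeasure lborel {arrival I j..} = top"
  proof (cases "emeasure lborel {arrival I j..}")
    case (real c)
    \<comment> \<open>If the half-line had finite measure \<open>c\<close>, it would still contain
      an interval of length \<open>c + 1\<close>.\<close>
    have "ennreal (c + 1) = emeasure lborel {arrival I j..arrival I j + (c + 1)}"
      using real by simp
    also have "\<dots> \<le> ennreal c"
      using emeasure_mono[of "{arrival I j..arrival I j + (c + 1)}" "{arrival I j..}" lborel] real
      by auto
    finally show ?thesis using real by (simp add: ennreal_le_iff)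
  qed
  moreover have "{t. j \<in> unsatisfied I r t} = {arrival I j..}"
    using False j by (auto simp: unsatisfied_def)
  ultimately show ?thesis
    using False by (simp add: satisfaction_time_def)
next
  case True
  define S where "S = {t. satisfied_by I r j t}"
  define f where "f = Inf S"
  have S: "S \<noteq> {}" "bdd_below S" "\<And>t. t \<in> S \<Longrightarrow> arrival I j \<le> t"
    using True by (auto simp: S_def satisfied_by_def intro: bdd_belowI)
  have f: "arrival I j \<le> f" unfolding f_def using S by (intro cInf_greatest) auto
  have ge: "f \<le> t" if "t \<in> S" for t unfolding f_def using that S(2) by (rule cInf_lower)
  have gt: "t \<in> S" if "f < t" for t
    using that S(1,2) cInf_less_iff[of S t] by (auto simp: f_def S_def intro: satisfied_by_mono)
  have "satisfaction_time I r j = ennreal f"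
  proof (rule antisym)
    have "satisfaction_time I r j \<le> ennreal f + ennreal e" if "0 < e" for e
    proof -
      have "f + e \<in> S" using gt that by simp
      then have "satisfaction_time I r j \<le> ennreal (f + e)"
        unfolding satisfaction_time_def S_def by (rule INF_lower)
      then show ?thesis using that f a by simp
    qed
    then show "satisfaction_time I r j \<le> ennreal f"
      by (rule ennreal_le_epsilon)
    show "ennreal f \<le> satisfaction_time I r j"
      unfolding satisfaction_time_def by (intro INF_greatest ennreal_leI ge) (auto simp: S_def)
  qed
  then have "satisfaction_time I r j - ennreal (arrival I j) = ennreal (f - arrival I j)"
    using a by (simp add: ennreal_minus)
  moreover have "emeasure lborel {t. j \<in> unsatisfied I r t} = ennreal (f - arrival I j)"
  proof (rule antisym)
    have "{t. j \<in> unsatisfied I r t} \<subseteq> {arrival I j..f}"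
      using gt by (force simp: unsatisfied_def S_def not_le)
    then show "emeasure lborel {t. j \<in> unsatisfied I r t} \<le> ennreal (f - arrival I j)"
      using emeasure_mono[of _ "{arrival I j..f}" lborel] f by simp
    have "{arrival I j..<f} \<subseteq> {t. j \<in> unsatisfied I r t}"
      using ge j by (force simp: unsatisfied_def S_def)
    then show "ennreal (f - arrival I j) \<le> emeasure lborel {t. j \<in> unsatisfied I r t}"
      using emeasure_mono[of "{arrival I j..<f}" "{t. j \<in> unsatisfied I r t}" lborel] f
        unsatisfied_borel[of j I r] by simp
  qed
  ultimately show ?thesis by simp
qed

lemma card_eq_sum_indicator:
  "N \<subseteq> {..<m} \<Longrightarrow> ennreal (real (card N)) = (\<Sum>j<m. indicator N j)" for m :: nat
proof -
  assume N: "N \<subseteq> {..<m}"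
  have "(\<Sum>j<m. indicator N j :: ennreal) = (\<Sum>j\<in>N. 1)"
    using N by (intro sum.mono_neutral_cong_right) (auto simp: indicator_def)
  then show ?thesis by (simp add: ennreal_of_nat_eq_real_of_nat)
qed

lemma total_flow_time_eq:
  assumes "broadcast_instance I"
  shows "total_flow_time I r = (\<integral>\<^sup>+ t. ennreal (real (card (unsatisfied I r t))) \<partial>lborel)"
proof -
  have "total_flow_time I r = (\<Sum>j<length (requests I). emeasure lborel {t. j \<in> unsatisfied I r t})"
    unfolding total_flow_time_def using assms
    by (intro sum.cong flow_time_eq_emeasure) (auto simp: broadcast_instance_def)
  also have "\<dots> = (\<Sum>j<length (requests I). \<integral>\<^sup>+ t. indicator (unsatisfied I r t) j \<partial>lborel)"
  proof (rule sum.cong[OF refl])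
    fix j
    have "indicator (unsatisfied I r t) j = (indicator {t. j \<in> unsatisfied I r t} t :: ennreal)" for t
      by (simp add: indicator_def)
    then show "emeasure lborel {t. j \<in> unsatisfied I r t} = (\<integral>\<^sup>+ t. indicator (unsatisfied I r t) j \<partial>lborel)"
      using unsatisfied_borel[of j I r] by simp
  qed
  also have "\<dots> = (\<integral>\<^sup>+ t. (\<Sum>j<length (requests I). indicator (unsatisfied I r t) j) \<partial>lborel)"
    by (intro nn_integral_sum[symmetric])
      (simp add: borel_of_unsatisfied[of "\<lambda>N. indicator N j" for j])
  also have "\<dots> = (\<integral>\<^sup>+ t. ennreal (real (card (unsatisfied I r t))) \<partial>lborel)"
    by (intro nn_integral_cong card_eq_sum_indicator[symmetric]) (auto simp: unsatisfied_def)
  finally show ?thesis .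
qed


section \<open>The rates of the algorithm\<close>

definition rank :: "nat set \<Rightarrow> nat \<Rightarrow> nat" where
  "rank N j = card {k \<in> N. k \<le> j}"

lemma rank_plus_later:
  assumes "finite N"
  shows "rank N j + card {k \<in> N. j < k} = card N"
proof -
  have "N = {k \<in> N. k \<le> j} \<union> {k \<in> N. j < k}" by auto
  then show ?thesis
    unfolding rank_def using card_Un_disjoint[of "{k \<in> N. k \<le> j}" "{k \<in> N. j < k}"] assms
    by (metis (mono_tags, lifting) disjoint_iff finite_Un linorder_not_le mem_Collect_eq)
qed

lemma rank_le_card: "finite N \<Longrightarrow> rank N j \<le> card N"
  using rank_plus_later[of N j] by simp

text \<open>The number of later elements is the position counted from the latest arrival, starting
  at 0. It strictly decreases along \<open>N\<close>, so it is injective, and its image fills a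
  range of the same size.\<close>

lemma bij_betw_later:
  assumes N: "finite (N :: nat set)"
  shows "bij_betw (\<lambda>j. card {k \<in> N. j < k}) N {..<card N}"
proof -
  let ?l = "\<lambda>j. card {k \<in> N. j < k}"
  have less: "?l j < ?l i" if "i < j" "j \<in> N" for i j
    using N that by (intro psubset_card_mono) auto
  have "inj_on ?l N"
  proof (rule inj_onI)
    fix i j assume "i \<in> N" "j \<in> N" "?l i = ?l j"
    then show "i = j" using less[of i j] less[of j i] by (cases i j rule: linorder_cases) auto
  qed
  moreover have "?l ` N \<subseteq> {..<card N}"
    using N by (auto intro!: psubset_card_mono)
  ultimately show ?thesis
    by (simp add: bij_betw_def card_image card_subset_eq)
qed

lemma contribution_nonneg:
  assumes "power_function P" "0 \<le> \<alpha>" "0 \<le> \<beta>"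
  shows "0 \<le> contribution P \<alpha> \<beta> N j"
  using assms power_speed[of P "real (card N)"]
  by (auto simp: contribution_def Let_def intro!: divide_nonneg_nonneg mult_nonneg_nonneg)

lemma contribution_le:
  fixes \<alpha> \<beta> :: real
  assumes "power_function P" "0 \<le> \<alpha>" "0 \<le> \<beta>"
  shows "contribution P \<alpha> \<beta> N j \<le> \<alpha> * speed_of_power P (card N) / (\<beta> * card N)"
proof -
  let ?x = "\<alpha> * speed_of_power P (card N) / (\<beta> * card N)"
  have "0 \<le> ?x" using assms power_speed[of P "real (card N)"] by simp
  moreover have "\<beta> * card N - of_int \<lfloor>\<beta> * card N\<rfloor> \<le> 1" by linarith
  ultimately show ?thesis
    using mult_right_mono[of "\<beta> * card N - of_int \<lfloor>\<beta> * card N\<rfloor>" 1 ?x]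
    by (auto simp: contribution_def Let_def)
qed

lemma rank_ge_of_contribution:
  fixes \<alpha> \<beta> :: real
  assumes "finite N" "contribution P \<alpha> \<beta> N j \<noteq> 0"
  shows "(1 - \<beta>) * card N \<le> rank N j"
proof -
  have "int (card {k \<in> N. j < k}) \<le> \<lfloor>\<beta> * card N\<rfloor>"
    using assms(2) by (auto simp: contribution_def Let_def split: if_splits)
  then have "real (card {k \<in> N. j < k}) \<le> \<beta> * card N"
    by (simp add: le_floor_iff)
  then show ?thesis
    using rank_plus_later[OF assms(1), of j] by (simp add: algebra_simps)
qed

text \<open>There are \<open>k\<close> full shares \<open>x\<close> and one share scaled by
  \<open>\<beta> * n - k\<close>, in total \<open>\<beta> * n\<close> shares.\<close>

lemma sum_contribution:
  fixes \<alpha> \<beta> :: real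
  assumes N: "finite N" "N \<noteq> {}" and \<beta>: "0 < \<beta>" "\<beta> < 1"
  shows "(\<Sum>j\<in>N. contribution P \<alpha> \<beta> N j) = \<alpha> * speed_of_power P (card N)"
proof -
  define n where "n = real (card N)"
  define x where "x = \<alpha> * speed_of_power P n / (\<beta> * n)"
  define k where "k = nat \<lfloor>\<beta> * n\<rfloor>"
  have n: "0 < n" using N by (auto simp: n_def card_gt_0_iff)
  have floor: "\<lfloor>\<beta> * n\<rfloor> = int k" using n \<beta> by (simp add: k_def)
  have "\<beta> * n < n" using n \<beta> by simp
  \<comment> \<open>Since \<open>\<beta> < 1\<close>, a request at position \<open>k\<close> exists
    to carry the fractional share.\<close>
  then have "k < card N" using floor unfolding n_def by linarith
  have "(\<Sum>j\<in>N. contribution P \<alpha> \<beta> N j) =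
      (\<Sum>j\<in>N. (\<lambda>l. if l < k then x else if l = k then (\<beta> * n - real k) * x else 0) (card {i \<in> N. j < i}))"
    by (intro sum.cong) (auto simp: contribution_def Let_def n_def[symmetric] x_def[symmetric] floor)
  also have "\<dots> = (\<Sum>l<card N. if l < k then x else if l = k then (\<beta> * n - real k) * x else 0)"
    by (rule sum.reindex_bij_betw[OF bij_betw_later[OF N(1)]])
  also have "\<dots> = (\<Sum>l<Suc k. if l < k then x else if l = k then (\<beta> * n - real k) * x else 0)"
    using \<open>k < card N\<close> by (intro sum.mono_neutral_right) auto
  also have "\<dots> = (\<beta> * n) * x" by (simp add: algebra_simps)
  also have "\<dots> = \<alpha> * speed_of_power P n" using n \<beta> by (simp add: x_def)
  finally show ?thesis by (simp add: n_def)
qed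

text \<open>Removing the requests of \<open>B\<close> costs at most a fraction \<open>card B / (\<beta> * card A)\<close> of the rate,
  since no single request contributes more than \<open>1 / (\<beta> * card A)\<close> of it.\<close>

lemma card_le_weighted_contributions:
  fixes \<alpha> \<beta> :: real
  assumes P: "power_function P" and A: "finite A" and B: "finite B"
    and \<alpha>: "0 \<le> \<alpha>" and \<beta>: "0 < \<beta>" "\<beta> < 1"
  shows "(1 - \<beta>) * \<alpha> * card A \<le>
    (\<Sum>j\<in>A - B. inverse_slope P (rank A j) * contribution P \<alpha> \<beta> A j) + (1 - \<beta>) * \<alpha> / \<beta> * card B"
proof (cases "A = {}")
  case True
  then show ?thesis using \<alpha> \<beta> by simp
next
  case False
  define n where "n = real (card A)"
  define q where "q = speed_of_power P n"
  define x where "x = contribution P \<alpha> \<beta> A"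
  \<comment> \<open>A common lower bound for the weights of all contributing requests: their rank is
    at least \<open>(1 - \<beta>) * n\<close>, and the speed belonging to that rank is at most
    \<open>q\<close>. A constant weight lets the total rate be inserted.\<close>
  define c where "c = (1 - \<beta>) * n / q"
  have n: "0 < n" using A False by (auto simp: n_def card_gt_0_iff)
  have q: "0 < q" unfolding q_def by (rule speed_pos[OF P n])
  have c: "0 \<le> c" using n q \<beta> by (simp add: c_def)
  have x0: "0 \<le> x j" for j unfolding x_def using \<alpha> \<beta> by (intro contribution_nonneg[OF P]) auto
  have "(1 - \<beta>) * \<alpha> * n = c * (\<alpha> * q)" using q by (simp add: c_def)
  also have "\<dots> = (\<Sum>j\<in>A. c * x j)"
    using sum_contribution[OF A False \<beta>, of P \<alpha>] by (simp add: sum_distrib_left[symmetric] x_def q_def n_def)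
  also have "\<dots> = (\<Sum>j\<in>A - B. c * x j) + (\<Sum>j\<in>A \<inter> B. c * x j)"
    using sum.Int_Diff[OF A, of "\<lambda>j. c * x j" B] by simp
  also have "(\<Sum>j\<in>A \<inter> B. c * x j) \<le> (\<Sum>j\<in>A \<inter> B. (1 - \<beta>) * \<alpha> / \<beta>)"
  proof (rule sum_mono)
    fix j
    have "c * x j \<le> c * (\<alpha> * q / (\<beta> * n))"
      using contribution_le[OF P \<alpha>, of \<beta> A j] \<beta> c
      by (intro mult_left_mono) (auto simp: x_def q_def n_def)
    also have "\<dots> = (1 - \<beta>) * \<alpha> / \<beta>" using n q by (simp add: c_def)
    finally show "c * x j \<le> (1 - \<beta>) * \<alpha> / \<beta>" .
  qed
  also have "\<dots> \<le> (1 - \<beta>) * \<alpha> / \<beta> * card B"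
    using card_mono[OF B, of "A \<inter> B"] \<alpha> \<beta>
      mult_left_mono[of "real (card (A \<inter> B))" "real (card B)" "(1 - \<beta>) * \<alpha> / \<beta>"]
    by (simp add: mult.commute)
  also have "(\<Sum>j\<in>A - B. c * x j) \<le> (\<Sum>j\<in>A - B. inverse_slope P (rank A j) * x j)"
  proof (rule sum_mono)
    fix j
    show "c * x j \<le> inverse_slope P (rank A j) * x j"
    proof (cases "x j = 0")
      case False
      then have r: "(1 - \<beta>) * n \<le> rank A j"
        using rank_ge_of_contribution[OF A] by (simp add: x_def n_def)
      have "0 < rank A j" using r n \<beta> by (metis mult_pos_pos diff_gt_0_iff_gt of_nat_0_less_iff less_le_trans)
      then have "0 < speed_of_power P (rank A j)" using speed_pos[OF P] by simp
      moreover have "speed_of_power P (rank A j) \<le> q"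
        unfolding q_def n_def using rank_le_card[OF A] by (intro speed_mono[OF P]) auto
      ultimately have "c \<le> inverse_slope P (rank A j)"
        unfolding c_def inverse_slope_def using r by (intro frac_le) auto
      then show ?thesis using x0 by (rule mult_right_mono)
    qed simp
  qed
  finally show ?thesis by (simp add: x_def n_def)
qed

section \<open>Charging the algorithm to an arbitrary schedule\<close>

lemma nn_integral_Icc_le_of_less:
  fixes f :: "real \<Rightarrow> ennreal"
  assumes [measurable]: "f \<in> borel_measurable borel"
    and le: "\<And>\<tau>. u \<le> \<tau> \<Longrightarrow> \<tau> < s \<Longrightarrow> (\<integral>\<^sup>+ x\<in>{u..\<tau>}. f x \<partial>lborel) \<le> c"
  shows "(\<integral>\<^sup>+ x\<in>{u..s}. f x \<partial>lborel) \<le> c"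
proof -
  define C where "C k = {u..s - 1 / real (Suc k)}" for k
  have "incseq C"
  proof (rule incseq_SucI)
    fix k
    have "1 / real (Suc (Suc k)) \<le> 1 / real (Suc k)" by (intro divide_left_mono) auto
    then show "C k \<subseteq> C (Suc k)" unfolding C_def by (auto simp del: of_nat_Suc)
  qed
  have Un: "(\<Union>k. C k) = {u..<s}"
  proof (intro equalityI subsetI)
    fix x assume x: "x \<in> {u..<s}"
    then obtain k where "inverse (real (Suc k)) < s - x" using reals_Archimedean[of "s - x"] by auto
    then show "x \<in> (\<Union>k. C k)" using x by (auto simp: C_def inverse_eq_divide intro!: exI[of _ k])
  next
    fix x assume "x \<in> (\<Union>k. C k)"
    then obtain k where "u \<le> x" "x \<le> s - 1 / real (Suc k)" by (auto simp: C_def)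
    moreover have "0 < 1 / real (Suc k)" by simp
    ultimately have "u \<le> x" "x < s" by linarith+
    then show "x \<in> {u..<s}" by simp
  qed
  have "(\<integral>\<^sup>+ x\<in>{u..s}. f x \<partial>lborel) = (\<integral>\<^sup>+ x\<in>{u..<s}. f x \<partial>lborel)"
    by (intro nn_integral_cong_AE, rule AE_mp[OF AE_lborel_singleton[of s]])
      (auto simp: indicator_def)
  also have "\<dots> = emeasure (density lborel f) (\<Union>k. C k)"
    unfolding Un by (simp add: emeasure_density)
  also have "\<dots> = (SUP k. emeasure (density lborel f) (C k))"
    by (intro SUP_emeasure_incseq[symmetric] \<open>incseq C\<close>) (auto simp: C_def)
  also have "\<dots> \<le> c"
  proof (rule SUP_least)
    fix k
    show "emeasure (density lborel f) (C k) \<le> c"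
    proof (cases "u \<le> s - 1 / real (Suc k)")
      case True
      have "0 < 1 / real (Suc k)" by simp
      then have "s - 1 / real (Suc k) < s" by linarith
      from le[OF True this] show ?thesis by (simp add: emeasure_density C_def)
    next
      case False
      then have "C k = {}" by (auto simp: C_def)
      then show ?thesis by simp
    qed
  qed
  finally show ?thesis .
qed

text \<open>With \<open>H t * (\<integral>\<^sup>+ v\<in>{t..}. g v) * (\<integral>\<^sup>+ u\<in>{a..t}. w u)\<close> as a potential, the left-hand side is its total
  decrease and the right-hand side its total increase.\<close>

lemma nn_integral_exchange:
  fixes H g w :: "real \<Rightarrow> ennreal"
  assumes [measurable]: "H \<in> borel_measurable borel" "g \<in> borel_measurable borel" "w \<in> borel_measurable borel"
    and mono: "\<And>u t. a \<le> u \<Longrightarrow> u \<le> t \<Longrightarrow> H t * g t \<le> H u * g t"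
  shows "(\<integral>\<^sup>+ t. H t * g t * (\<integral>\<^sup>+ u\<in>{a..t}. w u \<partial>lborel) \<partial>lborel) \<le>
    (\<integral>\<^sup>+ u\<in>{a..}. H u * w u * (\<integral>\<^sup>+ t\<in>{u..}. g t \<partial>lborel) \<partial>lborel)"
proof -
  let ?D = "{z. a \<le> fst z \<and> fst z \<le> snd z} :: (real \<times> real) set"
  have D [measurable]: "?D \<in> sets (borel \<Otimes>\<^sub>M borel)"
    unfolding borel_prod by (intro borel_closed closed_Collect_conj closed_Collect_le continuous_intros)
  have "(\<integral>\<^sup>+ t. H t * g t * (\<integral>\<^sup>+ u\<in>{a..t}. w u \<partial>lborel) \<partial>lborel) =
      (\<integral>\<^sup>+ t. \<integral>\<^sup>+ u. H t * g t * w u * indicator ?D (u, t) \<partial>lborel \<partial>lborel)"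
    by (subst nn_integral_cmult[symmetric])
      (auto intro!: nn_integral_cong simp: indicator_def mult.assoc)
  \<comment> \<open>The only inequality: on the triangle \<open>a \<le> u \<le> t\<close> the weight
    moves back from \<open>t\<close> to \<open>u\<close>. The rest is Tonelli's theorem.\<close>
  also have "\<dots> \<le> (\<integral>\<^sup>+ t. \<integral>\<^sup>+ u. H u * g t * w u * indicator ?D (u, t) \<partial>lborel \<partial>lborel)"
    by (intro nn_integral_mono) (auto simp: indicator_def intro!: mult_right_mono mono)
  also have "\<dots> = (\<integral>\<^sup>+ u. \<integral>\<^sup>+ t. H u * g t * w u * indicator ?D (u, t) \<partial>lborel \<partial>lborel)"
    by (rule lborel_pair.Fubini') measurable
  also have "\<dots> = (\<integral>\<^sup>+ u\<in>{a..}. H u * w u * (\<integral>\<^sup>+ t\<in>{u..}. g t \<partial>lborel) \<partial>lborel)"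
  proof (rule nn_integral_cong)
    fix u :: real
    have "(\<integral>\<^sup>+ t. H u * g t * w u * indicator ?D (u, t) \<partial>lborel) =
        (\<integral>\<^sup>+ t. (H u * w u * indicator {a..} u) * (g t * indicator {u..} t) \<partial>lborel)"
      by (intro nn_integral_cong) (auto simp: indicator_def ac_simps)
    also have "\<dots> = H u * w u * indicator {a..} u * (\<integral>\<^sup>+ t\<in>{u..}. g t \<partial>lborel)"
      by (rule nn_integral_cmult) measurable
    finally show "(\<integral>\<^sup>+ t. H u * g t * w u * indicator ?D (u, t) \<partial>lborel) =
        H u * w u * (\<integral>\<^sup>+ t\<in>{u..}. g t \<partial>lborel) * indicator {a..} u"
      by (simp add: ac_simps)
  qed
  finally show ?thesis .
qed


section \<open>Charges per request and per page\<close>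

lemma arrival_nonneg:
  "broadcast_instance I \<Longrightarrow> j < length (requests I) \<Longrightarrow> 0 \<le> arrival I j"
  by (auto simp: broadcast_instance_def)

lemma req_page_in_pages:
  "broadcast_instance I \<Longrightarrow> j < length (requests I) \<Longrightarrow> req_page I j \<in> pages I"
  by (force simp: broadcast_instance_def)

text \<open>Requests are listed by arrival, so those counted in the rank of \<open>j\<close> arrived
  no later than \<open>j\<close>. New arrivals never enter the count; satisfied requests only leave
  it.\<close>

lemma rank_antimono:
  assumes I: "broadcast_instance I" and j: "j \<in> unsatisfied I r t" and u: "arrival I j \<le> u" "u \<le> t"
  shows "rank (unsatisfied I r t) j \<le> rank (unsatisfied I r u) j"
  unfolding rank_def
proof (rule card_mono)
  show "{k \<in> unsatisfied I r t. k \<le> j} \<subseteq> {k \<in> unsatisfied I r u. k \<le> j}"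
  proof clarify
    fix k assume k: "k \<in> unsatisfied I r t" "k \<le> j"
    have "j < length (requests I)" using j by (simp add: unsatisfied_def)
    then have "arrival I k \<le> arrival I j"
      using I k sorted_nth_mono[of "map snd (requests I)" k j] by (simp add: broadcast_instance_def)
    with u k show "k \<in> unsatisfied I r u" by (auto intro: unsatisfied_antimono)
  qed
qed simp

text \<open>The value 0 outside \<open>N\<close> must be imposed: \<open>contribution\<close> can be
  positive at an index that is not in \<open>N\<close>.\<close>

definition request_rate ::
  "(real \<Rightarrow> real) \<Rightarrow> real \<Rightarrow> real \<Rightarrow> nat \<Rightarrow> nat set \<Rightarrow> ennreal" where
  "request_rate P \<alpha> \<beta> j N = (if j \<in> N then ennreal (contribution P \<alpha> \<beta> N j) else 0)"

text \<open>After time \<open>u\<close>, every broadcast of \<open>p\<close> counts for all requests for \<open>p\<close> that are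
  unsatisfied at \<open>u\<close>, and all their contributions precede the last of their satisfaction times.\<close>

lemma future_contributions_le_page_size:
  assumes P: "power_function P" and I: "broadcast_instance I"
    and r: "algorithm_schedule P \<alpha> \<beta> I r" and \<alpha>: "0 \<le> \<alpha>" and \<beta>: "0 \<le> \<beta>"
    and p: "p \<in> pages I"
  shows "(\<Sum>j\<in>{j \<in> unsatisfied I r u. req_page I j = p}.
      \<integral>\<^sup>+ t\<in>{u..T}. request_rate P \<alpha> \<beta> j (unsatisfied I r t) \<partial>lborel) \<le> ennreal (page_size I p)"
proof -
  define J where "J = {j \<in> unsatisfied I r u. req_page I j = p}"
  define S where "S = {t \<in> {u..T}. J \<inter> unsatisfied I r t \<noteq> {}}"
  have sch: "r p \<in> borel_measurable borel" "\<And>t. 0 \<le> r p t"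
    using r p by (auto simp: algorithm_schedule_def schedule_def)
  note [measurable] = sch(1)
  have "finite J" by (simp add: J_def)
  have J: "j < length (requests I)" "0 \<le> arrival I j" "arrival I j \<le> u" "req_page I j = p" if "j \<in> J" for j
    using that arrival_nonneg[OF I] by (auto simp: J_def unsatisfied_def)
  have meas: "(\<lambda>t. request_rate P \<alpha> \<beta> j (unsatisfied I r t)) \<in> borel_measurable borel" for j
    by (rule borel_of_unsatisfied[of "request_rate P \<alpha> \<beta> j"])
  have rate: "(\<Sum>j\<in>J. request_rate P \<alpha> \<beta> j (unsatisfied I r t)) \<le> ennreal (r p t)" if "t \<in> S" for t
  proof -
    let ?N = "unsatisfied I r t"
    obtain j where "j \<in> J" using \<open>t \<in> S\<close> by (auto simp: S_def)
    \<comment> \<open>The algorithm fixes the rates only from time 0 on, and \<open>t\<close> lies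
      after the arrival of some request.\<close>
    then have "0 \<le> t" using that J(2,3)[of j] by (simp add: S_def)
    have "(\<Sum>j\<in>J. request_rate P \<alpha> \<beta> j ?N) = (\<Sum>j\<in>J \<inter> ?N. ennreal (contribution P \<alpha> \<beta> ?N j))"
      using \<open>finite J\<close> by (simp add: request_rate_def sum.inter_restrict)
    also have "\<dots> = ennreal (\<Sum>j\<in>J \<inter> ?N. contribution P \<alpha> \<beta> ?N j)"
      using contribution_nonneg[OF P \<alpha> \<beta>] by (intro sum_ennreal) auto
    also have "(\<Sum>j\<in>J \<inter> ?N. contribution P \<alpha> \<beta> ?N j) \<le> (\<Sum>j\<in>{j \<in> ?N. req_page I j = p}. contribution P \<alpha> \<beta> ?N j)"
      using contribution_nonneg[OF P \<alpha> \<beta>] by (intro sum_mono2) (auto simp: J_def)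
    also have "\<dots> = r p t"
      using r p \<open>0 \<le> t\<close> by (simp add: algorithm_schedule_def)
    finally show ?thesis by (simp add: ennreal_leI)
  qed
  show ?thesis
  proof (cases "S = {}")
    case True
    then have zero: "request_rate P \<alpha> \<beta> j (unsatisfied I r t) * indicator {u..T} t = 0" if "j \<in> J" for j t
      using that by (auto simp: S_def request_rate_def indicator_def)
    have "(\<Sum>j\<in>J. \<integral>\<^sup>+ t\<in>{u..T}. request_rate P \<alpha> \<beta> j (unsatisfied I r t) \<partial>lborel) = 0"
    proof (intro sum.neutral ballI)
      fix j assume "j \<in> J"
      show "(\<integral>\<^sup>+ t\<in>{u..T}. request_rate P \<alpha> \<beta> j (unsatisfied I r t) \<partial>lborel) = 0"
        unfolding zero[OF \<open>j \<in> J\<close>] by simp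
    qed
    then show ?thesis unfolding J_def[symmetric] by simp
  next
    case False
    \<comment> \<open>The last time at which some request of \<open>J\<close> is still unsatisfied,
      possibly not in \<open>S\<close>. At each \<open>\<tau>\<close> in \<open>S\<close> an
      unsatisfied request of \<open>J\<close> certifies that less than one page size was sent
      between \<open>u\<close> and \<open>\<tau>\<close>; the limit from the left reaches
      \<open>s\<close>.\<close>
    define s where "s = Sup S"
    have bdd: "bdd_above S" by (auto simp: S_def intro: bdd_aboveI)
    have down: "\<tau> \<in> S" if "t \<in> S" "u \<le> \<tau>" "\<tau> \<le> t" for t \<tau>
    proof -
      obtain j where j: "j \<in> J" "j \<in> unsatisfied I r t" using \<open>t \<in> S\<close> by (auto simp: S_def)
      then have "j \<in> unsatisfied I r \<tau>" using that J(3)[of j] by (auto intro: unsatisfied_antimono)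
      with j that show ?thesis by (auto simp: S_def)
    qed
    have budget: "(\<integral>\<^sup>+ x\<in>{u..\<tau>}. ennreal (r p x) \<partial>lborel) \<le> ennreal (page_size I p)" if "\<tau> \<in> S" for \<tau>
    proof -
      obtain j where j: "j \<in> J" "j \<in> unsatisfied I r \<tau>" using \<open>\<tau> \<in> S\<close> by (auto simp: S_def)
      have "(\<integral>\<^sup>+ x\<in>{u..\<tau>}. ennreal (r p x) \<partial>lborel) \<le> amount_broadcast r p (arrival I j) \<tau>"
        unfolding amount_broadcast_def using J(3)[OF j(1)]
        by (intro nn_integral_mono) (auto simp: indicator_def)
      also have "\<dots> \<le> ennreal (page_size I p)"
        using j J(4)[OF j(1)] by (auto simp: unsatisfied_def satisfied_by_def)
      finally show ?thesis .
    qed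
    have "(\<Sum>j\<in>J. \<integral>\<^sup>+ t\<in>{u..T}. request_rate P \<alpha> \<beta> j (unsatisfied I r t) \<partial>lborel) =
        (\<integral>\<^sup>+ t. (\<Sum>j\<in>J. request_rate P \<alpha> \<beta> j (unsatisfied I r t) * indicator {u..T} t) \<partial>lborel)"
      by (intro nn_integral_sum[symmetric]) (use meas in measurable)
    also have "\<dots> \<le> (\<integral>\<^sup>+ t\<in>{u..s}. ennreal (r p t) \<partial>lborel)"
    proof (rule nn_integral_mono)
      fix t
      show "(\<Sum>j\<in>J. request_rate P \<alpha> \<beta> j (unsatisfied I r t) * indicator {u..T} t) \<le>
          ennreal (r p t) * indicator {u..s} t"
      proof (cases "t \<in> S")
        case True
        then have "t \<in> {u..s}" unfolding s_def using cSup_upper[OF True bdd] by (simp add: S_def)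
        moreover have "t \<in> {u..T}" using True by (simp add: S_def)
        ultimately show ?thesis using rate[OF True] by simp
      next
        case False
        then have zero: "request_rate P \<alpha> \<beta> j (unsatisfied I r t) * indicator {u..T} t = 0" if "j \<in> J" for j
          using that by (auto simp: S_def request_rate_def indicator_def)
        have "(\<Sum>j\<in>J. request_rate P \<alpha> \<beta> j (unsatisfied I r t) * indicator {u..T} t) = 0"
          using zero by (intro sum.neutral ballI)
        then show ?thesis by simp
      qed
    qed
    also have "\<dots> \<le> ennreal (page_size I p)"
    proof (rule nn_integral_Icc_le_of_less)
      fix \<tau> assume "u \<le> \<tau>" "\<tau> < s"
      then obtain t where "t \<in> S" "\<tau> < t" unfolding s_def using less_cSup_iff[OF False bdd] by auto
      then have "\<tau> \<in> S" using down[of t \<tau>] \<open>u \<le> \<tau>\<close> by simp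
      then show "(\<integral>\<^sup>+ x\<in>{u..\<tau>}. ennreal (r p x) \<partial>lborel) \<le> ennreal (page_size I p)"
        by (rule budget)
    qed measurable
    finally show ?thesis unfolding J_def .
  qed
qed

definition request_slope :: "(real \<Rightarrow> real) \<Rightarrow> nat \<Rightarrow> nat set \<Rightarrow> ennreal" where
  "request_slope P j N = (if j \<in> N then ennreal (inverse_slope P (rank N j)) else 0)"

text \<open>Once \<open>y\<close> has satisfied \<open>j\<close>, the fractions of the page that
  \<open>y\<close> sent since the arrival integrate to at least 1. Inserting this integral as a
  factor only increases the left-hand side, and \<open>nn_integral_exchange\<close> then moves the
  charge to the times at which \<open>y\<close> sent the page.\<close>

lemma charge_request:
  assumes P: "power_function P" and I: "broadcast_instance I" and y: "schedule I y"
    and j: "j < length (requests I)"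
  shows "(\<integral>\<^sup>+ t\<in>{..T}. request_slope P j (unsatisfied I r t) * request_rate P \<alpha> \<beta> j (unsatisfied I r t) *
        indicator (- unsatisfied I y t) j \<partial>lborel) \<le>
    (\<integral>\<^sup>+ u. ennreal (y (req_page I j) u / page_size I (req_page I j)) * request_slope P j (unsatisfied I r u) *
        (\<integral>\<^sup>+ t\<in>{u..T}. request_rate P \<alpha> \<beta> j (unsatisfied I r t) \<partial>lborel) \<partial>lborel)"
proof -
  let ?a = "arrival I j" and ?p = "req_page I j"
  let ?\<sigma> = "page_size I ?p"
  define H where "H t = request_slope P j (unsatisfied I r t)" for t
  \<comment> \<open>The cutoff at \<open>T\<close> is put into \<open>g\<close>, so that the
    exchange can be applied on the whole line.\<close>
  define g where "g t = request_rate P \<alpha> \<beta> j (unsatisfied I r t) * indicator {..T} t" for t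
  define w where "w u = ennreal (y ?p u / ?\<sigma>)" for u
  have p: "?p \<in> pages I" using req_page_in_pages[OF I j] .
  have \<sigma>: "0 < ?\<sigma>" using I p by (simp add: broadcast_instance_def)
  have y': "y ?p \<in> borel_measurable borel" "\<And>t. 0 \<le> y ?p t"
    using y p by (auto simp: schedule_def)
  have [measurable]: "H \<in> borel_measurable borel"
    unfolding H_def by (rule borel_of_unsatisfied[of "request_slope P j"])
  have [measurable]: "(\<lambda>t. request_rate P \<alpha> \<beta> j (unsatisfied I r t)) \<in> borel_measurable borel"
    by (rule borel_of_unsatisfied[of "request_rate P \<alpha> \<beta> j"])
  have [measurable]: "g \<in> borel_measurable borel" "w \<in> borel_measurable borel"
    unfolding g_def w_def using y'(1) by measurable
  have served: "1 \<le> (\<integral>\<^sup>+ u\<in>{?a..t}. w u \<partial>lborel)"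
    if "j \<in> unsatisfied I r t" "j \<notin> unsatisfied I y t" for t
  proof -
    have "ennreal ?\<sigma> \<le> amount_broadcast y ?p ?a t"
      using that by (auto simp: unsatisfied_def satisfied_by_def)
    also have "\<dots> = (\<integral>\<^sup>+ u. ennreal ?\<sigma> * (w u * indicator {?a..t} u) \<partial>lborel)"
      unfolding amount_broadcast_def w_def using \<sigma> y'(2)
      by (intro nn_integral_cong) (auto simp: indicator_def ennreal_mult[symmetric])
    also have "\<dots> = ennreal ?\<sigma> * (\<integral>\<^sup>+ u\<in>{?a..t}. w u \<partial>lborel)"
      by (rule nn_integral_cmult) measurable
    finally have "ennreal ?\<sigma> * 1 \<le> ennreal ?\<sigma> * (\<integral>\<^sup>+ u\<in>{?a..t}. w u \<partial>lborel)" by simp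
    then show ?thesis using \<sigma> by (subst (asm) ennreal_mult_le_mult_iff) auto
  qed
  have "(\<integral>\<^sup>+ t\<in>{..T}. request_slope P j (unsatisfied I r t) * request_rate P \<alpha> \<beta> j (unsatisfied I r t) *
        indicator (- unsatisfied I y t) j \<partial>lborel) \<le>
      (\<integral>\<^sup>+ t. H t * g t * (\<integral>\<^sup>+ u\<in>{?a..t}. w u \<partial>lborel) \<partial>lborel)"
  proof (rule nn_integral_mono)
    fix t
    show "request_slope P j (unsatisfied I r t) * request_rate P \<alpha> \<beta> j (unsatisfied I r t) *
        indicator (- unsatisfied I y t) j * indicator {..T} t \<le>
        H t * g t * (\<integral>\<^sup>+ u\<in>{?a..t}. w u \<partial>lborel)"
    proof (cases "j \<in> unsatisfied I r t \<and> j \<notin> unsatisfied I y t")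
      case True
      then show ?thesis
        using mult_left_mono[OF served[of t], of "H t * g t"] by (simp add: H_def g_def mult.assoc)
    qed (auto simp: request_slope_def)
  qed
  also have "\<dots> \<le> (\<integral>\<^sup>+ u\<in>{?a..}. H u * w u * (\<integral>\<^sup>+ t\<in>{u..}. g t \<partial>lborel) \<partial>lborel)"
  proof (rule nn_integral_exchange)
    fix u t assume u: "?a \<le> u" "u \<le> t"
    show "H t * g t \<le> H u * g t"
    proof (cases "j \<in> unsatisfied I r t")
      case True
      then have "j \<in> unsatisfied I r u" using u by (rule unsatisfied_antimono)
      then have "H t \<le> H u"
        using True rank_antimono[OF I True u]
        by (simp add: H_def request_slope_def ennreal_leI inverse_slope_mono[OF P])
      then show ?thesis by (rule mult_right_mono) simp
    qed (simp add: g_def request_rate_def)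
  qed measurable
  also have "\<dots> \<le> (\<integral>\<^sup>+ u. w u * H u * (\<integral>\<^sup>+ t\<in>{u..}. g t \<partial>lborel) \<partial>lborel)"
    by (intro nn_integral_mono) (auto simp: indicator_def mult.commute)
  also have "\<dots> = (\<integral>\<^sup>+ u. w u * H u * (\<integral>\<^sup>+ t\<in>{u..T}. request_rate P \<alpha> \<beta> j (unsatisfied I r t) \<partial>lborel) \<partial>lborel)"
  proof (rule nn_integral_cong)
    fix u
    have "(\<integral>\<^sup>+ t\<in>{u..}. g t \<partial>lborel) = (\<integral>\<^sup>+ t\<in>{u..T}. request_rate P \<alpha> \<beta> j (unsatisfied I r t) \<partial>lborel)"
      by (intro nn_integral_cong) (auto simp: g_def indicator_def)
    then show "w u * H u * (\<integral>\<^sup>+ t\<in>{u..}. g t \<partial>lborel) =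
        w u * H u * (\<integral>\<^sup>+ t\<in>{u..T}. request_rate P \<alpha> \<beta> j (unsatisfied I r t) \<partial>lborel)"
      by simp
  qed
  finally show ?thesis by (simp add: w_def H_def)
qed

text \<open>At a fixed \<open>u\<close> each rank is at most the number of unsatisfied requests,
  which gives a common slope. Grouped by page, the remaining contributions are at most the page
  size, and this cancels the denominator in the rate of \<open>y\<close>.\<close>

lemma charge_all_requests:
  assumes P: "power_function P" and I: "broadcast_instance I" and y: "schedule I y"
    and r: "algorithm_schedule P \<alpha> \<beta> I r" and \<alpha>: "0 \<le> \<alpha>" and \<beta>: "0 \<le> \<beta>"
  shows "(\<Sum>j<length (requests I). \<integral>\<^sup>+ t\<in>{..T}. request_slope P j (unsatisfied I r t) *
        request_rate P \<alpha> \<beta> j (unsatisfied I r t) * indicator (- unsatisfied I y t) j \<partial>lborel) \<le>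
    (\<integral>\<^sup>+ u\<in>{0..T}. ennreal (inverse_slope P (card (unsatisfied I r u)) * (\<Sum>p\<in>pages I. y p u)) \<partial>lborel)"
proof -
  define m where "m = length (requests I)"
  define X where "X j u = (\<integral>\<^sup>+ t\<in>{u..T}. request_rate P \<alpha> \<beta> j (unsatisfied I r t) \<partial>lborel)" for j u
  define w where "w p u = ennreal (y p u / page_size I p)" for p u
  have \<sigma>: "0 < page_size I p" if "p \<in> pages I" for p
    using I that by (auto simp: broadcast_instance_def)
  have fin: "finite (pages I)" using I by (simp add: broadcast_instance_def)
  have y': "y p \<in> borel_measurable borel" "0 \<le> y p t" if "p \<in> pages I" for p t
    using y that by (auto simp: schedule_def)
  have meas: "(\<lambda>u. w (req_page I j) u * request_slope P j (unsatisfied I r u) * X j u) \<in> borel_measurable lborel"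
    if "j < m" for j
  proof -
    have [measurable]: "y (req_page I j) \<in> borel_measurable borel"
      using y'(1) req_page_in_pages[OF I, of j] that by (simp add: m_def)
    have [measurable]: "(\<lambda>t. request_rate P \<alpha> \<beta> j (unsatisfied I r t)) \<in> borel_measurable borel"
      by (rule borel_of_unsatisfied[of "request_rate P \<alpha> \<beta> j"])
    have [measurable]: "(\<lambda>t. request_slope P j (unsatisfied I r t)) \<in> borel_measurable borel"
      by (rule borel_of_unsatisfied[of "request_slope P j"])
    have "{z. fst z \<le> snd z \<and> snd z \<le> T} \<in> sets (borel \<Otimes>\<^sub>M borel :: (real \<times> real) measure)"
      unfolding borel_prod by (intro borel_closed closed_Collect_conj closed_Collect_le continuous_intros)
    note [measurable] = this
    \<comment> \<open>Writing the variable range \<open>{u..T}\<close> as a section of a fixed set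
      in the plane makes \<open>X j\<close> measurable in \<open>u\<close>.\<close>
    have "X j = (\<lambda>u. \<integral>\<^sup>+ t. request_rate P \<alpha> \<beta> j (unsatisfied I r t) *
        indicator {z. fst z \<le> snd z \<and> snd z \<le> T} (u, t) \<partial>lborel)"
      unfolding X_def by (intro ext nn_integral_cong) (auto simp: indicator_def)
    also have "\<dots> \<in> borel_measurable lborel"
      by measurable
    finally have [measurable]: "X j \<in> borel_measurable borel" by simp
    show ?thesis unfolding w_def by measurable
  qed
  have "(\<Sum>j<m. \<integral>\<^sup>+ t\<in>{..T}. request_slope P j (unsatisfied I r t) *
        request_rate P \<alpha> \<beta> j (unsatisfied I r t) * indicator (- unsatisfied I y t) j \<partial>lborel) \<le>
      (\<Sum>j<m. \<integral>\<^sup>+ u. w (req_page I j) u * request_slope P j (unsatisfied I r u) * X j u \<partial>lborel)"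
    unfolding w_def X_def m_def by (intro sum_mono charge_request[OF P I y]) auto
  also have "\<dots> = (\<integral>\<^sup>+ u. (\<Sum>j<m. w (req_page I j) u * request_slope P j (unsatisfied I r u) * X j u) \<partial>lborel)"
    by (intro nn_integral_sum[symmetric] meas) auto
  also have "\<dots> \<le> (\<integral>\<^sup>+ u\<in>{0..T}. ennreal (inverse_slope P (card (unsatisfied I r u)) * (\<Sum>p\<in>pages I. y p u)) \<partial>lborel)"
  proof (rule nn_integral_mono)
    fix u
    let ?N = "unsatisfied I r u"
    let ?h = "inverse_slope P (card ?N)"
    have N: "?N \<subseteq> {..<m}" by (auto simp: unsatisfied_def m_def)
    have "(\<Sum>j<m. w (req_page I j) u * request_slope P j ?N * X j u) =
        (\<Sum>j\<in>?N. w (req_page I j) u * request_slope P j ?N * X j u)"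
      using N by (intro sum.mono_neutral_right) (auto simp: request_slope_def)
    also have "\<dots> \<le> (\<Sum>j\<in>?N. w (req_page I j) u * ennreal ?h * X j u)"
      by (intro sum_mono mult_right_mono mult_left_mono)
        (auto simp: request_slope_def intro!: ennreal_leI inverse_slope_mono[OF P] rank_le_card)
    finally have le: "(\<Sum>j<m. w (req_page I j) u * request_slope P j ?N * X j u) \<le>
        (\<Sum>j\<in>?N. w (req_page I j) u * ennreal ?h * X j u)" .
    show "(\<Sum>j<m. w (req_page I j) u * request_slope P j ?N * X j u) \<le>
        ennreal (?h * (\<Sum>p\<in>pages I. y p u)) * indicator {0..T} u"
    proof (cases "u \<in> {0..T}")
      case False
      \<comment> \<open>Outside \<open>{0..T}\<close> the charge vanishes: no request has arrived
        before 0, and after \<open>T\<close> the range of integration in \<open>X\<close> is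
        empty.\<close>
      have "?N = {}" if "u < 0"
        using that arrival_nonneg[OF I] by (force simp: unsatisfied_def)
      moreover have "X j u = 0" if "T < u" for j using that by (simp add: X_def)
      ultimately show ?thesis using le False by auto
    next
      case True
      note le
      also have "(\<Sum>j\<in>?N. w (req_page I j) u * ennreal ?h * X j u) =
          (\<Sum>p\<in>pages I. \<Sum>j\<in>{j \<in> ?N. req_page I j = p}. w (req_page I j) u * ennreal ?h * X j u)"
        using fin N req_page_in_pages[OF I] by (intro sum.group[symmetric]) (auto simp: m_def)
      also have "\<dots> = (\<Sum>p\<in>pages I. w p u * ennreal ?h * (\<Sum>j\<in>{j \<in> ?N. req_page I j = p}. X j u))"
        by (simp add: sum_distrib_left)
      also have "\<dots> \<le> (\<Sum>p\<in>pages I. w p u * ennreal ?h * ennreal (page_size I p))"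
        unfolding X_def
        by (intro sum_mono mult_left_mono future_contributions_le_page_size[OF P I r \<alpha> \<beta>]) auto
      also have "\<dots> = (\<Sum>p\<in>pages I. ennreal (?h * y p u))"
      proof (rule sum.cong[OF refl])
        fix p assume "p \<in> pages I"
        then show "w p u * ennreal ?h * ennreal (page_size I p) = ennreal (?h * y p u)"
          using \<sigma>[of p] y'(2)[of p u] inverse_slope_nonneg[OF P]
          by (simp add: w_def ennreal_mult[symmetric] mult.commute)
      qed
      also have "\<dots> = ennreal (?h * (\<Sum>p\<in>pages I. y p u))"
        using y'(2) inverse_slope_nonneg[OF P] by (simp add: sum_distrib_left sum_ennreal)
      finally show ?thesis using True by simp
    qed
  qed
  finally show ?thesis by (simp add: m_def)
qed


section \<open>From charges to the competitive ratio\<close>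

text \<open>The factor 2 on the left stands for flow time and energy, since the algorithm is charged
  power \<open>n\<close> while \<open>n\<close> requests are unsatisfied. The cutoff
  \<open>T\<close> makes the integral \<open>A\<close> finite, so that it can be subtracted.\<close>

lemma flow_plus_energy_until:
  assumes P: "power_function P" and I: "broadcast_instance I" and \<epsilon>: "0 < \<epsilon>" "\<epsilon> \<le> 1 / 6"
    and r: "algorithm_schedule P (1 + 6 * \<epsilon>) \<epsilon> I r" and y: "schedule I y"
  shows "2 * (\<integral>\<^sup>+ t\<in>{..T}. ennreal (real (card (unsatisfied I r t))) \<partial>lborel) \<le>
    ennreal (2 / \<epsilon>\<^sup>2) * (total_flow_time I y + energy P I y)"
proof -
  define m where "m = length (requests I)"
  define n where "n t = real (card (unsatisfied I r t))" for t
  define b where "b t = real (card (unsatisfied I y t))" for t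
  define s where "s t = (\<Sum>p\<in>pages I. y p t)" for t
  define L where "L j t = request_slope P j (unsatisfied I r t) *
    request_rate P (1 + 6 * \<epsilon>) \<epsilon> j (unsatisfied I r t) * indicator (- unsatisfied I y t) j" for j t
  define k1 where "k1 = (1 - \<epsilon>) * (1 + 6 * \<epsilon>)"
  define k2 where "k2 = (1 - \<epsilon>) * (1 + 6 * \<epsilon>) / \<epsilon>"
  define A where "A = (\<integral>\<^sup>+ t\<in>{..T}. ennreal (n t) \<partial>lborel)"
  define F where "F = total_flow_time I y"
  define E where "E = energy P I y"
  \<comment> \<open>This is where \<open>\<epsilon> \<le> 1 / 6\<close> enters: it absorbs the
    quadratic term of \<open>k1\<close> into one of the five \<open>\<epsilon>\<close>.\<close>
  have sq: "0 \<le> \<epsilon> * \<epsilon>" "6 * (\<epsilon> * \<epsilon>) \<le> \<epsilon>"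
    using mult_left_mono[of \<epsilon> "1 / 6" \<epsilon>] \<epsilon> by auto
  have "k1 = 1 + 5 * \<epsilon> - 6 * (\<epsilon> * \<epsilon>)" by (simp add: k1_def algebra_simps)
  then have k1: "1 + 4 * \<epsilon> \<le> k1" "k1 \<le> 2" using sq \<epsilon> by linarith+
  have k: "0 \<le> k1" "0 \<le> k2" using k1 \<epsilon> by (auto simp: k2_def)
  have n0: "0 \<le> n t" and b0: "0 \<le> b t" for t by (auto simp: n_def b_def)
  have y': "y p \<in> borel_measurable borel" "0 \<le> y p t" if "p \<in> pages I" for p t
    using y that by (auto simp: schedule_def)
  have s: "s \<in> borel_measurable borel" "0 \<le> s t" for t
    unfolding s_def using y' by (auto intro!: borel_measurable_sum sum_nonneg)
  have [measurable]: "n \<in> borel_measurable borel" "b \<in> borel_measurable borel"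
    unfolding n_def b_def by (intro borel_of_unsatisfied)+
  have [measurable]: "(\<lambda>t. P (s t)) \<in> borel_measurable borel" by (rule power_measurable[OF P s])
  have [measurable]: "L j \<in> borel_measurable borel" for j
  proof -
    have [measurable]: "(\<lambda>t. request_rate P (1 + 6 * \<epsilon>) \<epsilon> j (unsatisfied I r t)) \<in> borel_measurable borel"
      by (rule borel_of_unsatisfied[of "request_rate P (1 + 6 * \<epsilon>) \<epsilon> j"])
    have [measurable]: "(\<lambda>t. request_slope P j (unsatisfied I r t)) \<in> borel_measurable borel"
      by (rule borel_of_unsatisfied[of "request_slope P j"])
    have [measurable]: "(\<lambda>t. indicator (- unsatisfied I y t) j :: ennreal) \<in> borel_measurable borel"
      by (rule borel_of_unsatisfied[of "\<lambda>N. indicator (- N) j"])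
    show ?thesis unfolding L_def by measurable
  qed
  have neg: "n t = 0" if "t < 0" for t
    using that arrival_nonneg[OF I] by (force simp: n_def unsatisfied_def)
  have A0: "A = (\<integral>\<^sup>+ t\<in>{0..T}. ennreal (n t) \<partial>lborel)"
    unfolding A_def using neg by (intro nn_integral_cong) (auto simp: indicator_def)
  have "A \<le> (\<integral>\<^sup>+ t. ennreal (real m) * indicator {0..T} t \<partial>lborel)"
    unfolding A0 n_def m_def using card_unsatisfied_le[of I r]
    by (intro nn_integral_mono mult_right_mono ennreal_leI) auto
  also have "\<dots> = ennreal (real m) * emeasure lborel {0..T}"
    by (rule nn_integral_cmult_indicator) simp
  also have "\<dots> < top" by (cases "0 \<le> T") (auto simp: ennreal_mult_less_top)
  finally have A_fin: "A < top" .
  have F: "F = (\<integral>\<^sup>+ t. ennreal (b t) \<partial>lborel)"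
    unfolding F_def b_def by (rule total_flow_time_eq[OF I])
  have pointwise: "ennreal (k1 * n t) \<le> (\<Sum>j<m. L j t) + ennreal (k2 * b t)" for t
  proof -
    let ?N = "unsatisfied I r t" and ?B = "unsatisfied I y t"
    let ?c = "\<lambda>j. inverse_slope P (rank ?N j) * contribution P (1 + 6 * \<epsilon>) \<epsilon> ?N j"
    have c0: "0 \<le> contribution P (1 + 6 * \<epsilon>) \<epsilon> ?N j" for j
      using \<epsilon> by (intro contribution_nonneg[OF P]) auto
    then have nonneg: "0 \<le> ?c j" for j
      using inverse_slope_nonneg[OF P] by simp
    have "k1 * n t \<le> (\<Sum>j\<in>?N - ?B. ?c j) + k2 * b t"
      using card_le_weighted_contributions[OF P, of ?N ?B "1 + 6 * \<epsilon>" \<epsilon>] \<epsilon>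
      by (simp add: k1_def k2_def n_def b_def)
    then have "ennreal (k1 * n t) \<le> ennreal (\<Sum>j\<in>?N - ?B. ?c j) + ennreal (k2 * b t)"
      using nonneg b0[of t] k by (simp add: ennreal_leI sum_nonneg flip: ennreal_plus)
    also have "ennreal (\<Sum>j\<in>?N - ?B. ?c j) = (\<Sum>j\<in>?N - ?B. ennreal (?c j))"
      using nonneg by (intro sum_ennreal[symmetric])
    also have "\<dots> = (\<Sum>j<m. L j t)"
      using c0 inverse_slope_nonneg[OF P]
      by (intro sum.mono_neutral_cong_left)
        (auto simp: L_def request_slope_def request_rate_def ennreal_mult m_def unsatisfied_def)
    finally show ?thesis .
  qed
  have "ennreal k1 * A = (\<integral>\<^sup>+ t\<in>{..T}. ennreal (k1 * n t) \<partial>lborel)"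
    unfolding A_def using k n0 by (subst nn_integral_cmult[symmetric]) (auto simp: ennreal_mult mult.assoc)
  also have "\<dots> \<le> (\<integral>\<^sup>+ t. (\<Sum>j<m. L j t * indicator {..T} t) + ennreal k2 * ennreal (b t) \<partial>lborel)"
  proof (rule nn_integral_mono)
    fix t
    show "ennreal (k1 * n t) * indicator {..T} t \<le> (\<Sum>j<m. L j t * indicator {..T} t) + ennreal k2 * ennreal (b t)"
      using pointwise[of t] k b0 by (cases "t \<le> T") (simp_all add: ennreal_mult)
  qed
  also have "\<dots> = (\<integral>\<^sup>+ t. (\<Sum>j<m. L j t * indicator {..T} t) \<partial>lborel) + (\<integral>\<^sup>+ t. ennreal k2 * ennreal (b t) \<partial>lborel)"
    by (rule nn_integral_add) measurable
  also have "(\<integral>\<^sup>+ t. (\<Sum>j<m. L j t * indicator {..T} t) \<partial>lborel) = (\<Sum>j<m. \<integral>\<^sup>+ t\<in>{..T}. L j t \<partial>lborel)"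
    by (rule nn_integral_sum) measurable
  also have "(\<integral>\<^sup>+ t. ennreal k2 * ennreal (b t) \<partial>lborel) = ennreal k2 * F"
    unfolding F by (rule nn_integral_cmult) measurable
  also have "(\<Sum>j<m. \<integral>\<^sup>+ t\<in>{..T}. L j t \<partial>lborel) \<le>
      (\<integral>\<^sup>+ t\<in>{0..T}. ennreal (inverse_slope P (card (unsatisfied I r t)) * s t) \<partial>lborel)"
    unfolding L_def m_def s_def using \<epsilon> by (intro charge_all_requests[OF P I y r]) auto
  also have "\<dots> \<le> (\<integral>\<^sup>+ t. ennreal (n t) * indicator {0..T} t + ennreal (P (s t)) * indicator {0..} t \<partial>lborel)"
  proof (rule nn_integral_mono)
    fix t
    have "ennreal (inverse_slope P (card (unsatisfied I r t)) * s t) \<le> ennreal (n t) + ennreal (P (s t))"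
      using inverse_slope_times_speed_le[OF P s(2), of "card (unsatisfied I r t)" t] n0[of t] power_nonneg[OF P s(2)]
      by (simp add: n_def ennreal_leI flip: ennreal_plus)
    then show "ennreal (inverse_slope P (card (unsatisfied I r t)) * s t) * indicator {0..T} t \<le>
        ennreal (n t) * indicator {0..T} t + ennreal (P (s t)) * indicator {0..} t"
      by (auto simp: indicator_def)
  qed
  also have "\<dots> = A + E"
    unfolding A0 E_def energy_def s_def[symmetric] by (rule nn_integral_add) measurable
  finally have main: "ennreal k1 * A \<le> A + E + ennreal k2 * F" by (simp add: add_mono)
  have "2 * A \<le> ennreal (2 / \<epsilon>\<^sup>2) * (F + E)"
  proof (cases "F + E = top")
    case True
    show ?thesis unfolding True using \<epsilon> by (simp add: ennreal_mult_top)
  next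
    case False
    then obtain f e where fe: "F = ennreal f" "0 \<le> f" "E = ennreal e" "0 \<le> e"
      by (cases F; cases E) auto
    obtain a where a: "A = ennreal a" "0 \<le> a" using A_fin by (cases A) auto
    have "k1 * a \<le> a + e + k2 * f"
      using main fe a k by (simp flip: ennreal_mult ennreal_plus)
    \<comment> \<open>Multiplying by \<open>\<epsilon>\<close> turns \<open>k2\<close> into
      \<open>k1\<close>, which is at most 2.\<close>
    then have "\<epsilon> * (k1 * a) \<le> \<epsilon> * (a + e + k2 * f)" using \<epsilon> by simp
    also have "\<dots> = \<epsilon> * a + \<epsilon> * e + \<epsilon> * k2 * f" by (simp add: algebra_simps)
    also have "\<epsilon> * k2 = k1" using \<epsilon> by (simp add: k1_def k2_def)
    finally have *: "\<epsilon> * (k1 - 1) * a \<le> \<epsilon> * e + k1 * f" by (simp add: algebra_simps)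
    have "\<epsilon> * (4 * \<epsilon>) * a \<le> \<epsilon> * (k1 - 1) * a"
      using \<epsilon> a k1 by (intro mult_left_mono mult_right_mono) auto
    moreover have "k1 * f \<le> 2 * f" using k1 fe by (intro mult_right_mono)
    moreover have "\<epsilon> * e \<le> 2 * e" using \<epsilon> fe by (intro mult_right_mono) auto
    ultimately have "4 * \<epsilon>\<^sup>2 * a \<le> 2 * (f + e)" using * by (simp add: power2_eq_square)
    moreover have "0 \<le> \<epsilon>\<^sup>2 * a" using a by simp
    \<comment> \<open>Half of the left-hand side is given up to match the constant
      \<open>2 / \<epsilon>\<^sup>2\<close>.\<close>
    ultimately have "2 * \<epsilon>\<^sup>2 * a \<le> 2 * (f + e)" by linarith
    then have "2 * a \<le> 2 / \<epsilon>\<^sup>2 * (f + e)" using \<epsilon> by (simp add: field_simps)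
    moreover have "2 * A = ennreal (2 * a)" using a by (simp add: ennreal_mult)
    ultimately show ?thesis using fe \<epsilon> by (simp add: ennreal_leI flip: ennreal_mult ennreal_plus)
  qed
  then show ?thesis by (simp add: A_def F_def E_def n_def)
qed

text \<open>The charged power equals the number of unsatisfied requests, so the energy is at most
  the flow time. Monotone convergence removes the cutoff.\<close>

lemma algorithm_flow_plus_energy_le:
  assumes P: "power_function P" and I: "broadcast_instance I" and \<epsilon>: "0 < \<epsilon>" "\<epsilon> \<le> 1 / 6"
    and r: "algorithm_schedule P (1 + 6 * \<epsilon>) \<epsilon> I r" and y: "schedule I y"
  shows "total_flow_time I r + algorithm_energy P I r \<le>
    ennreal (2 / \<epsilon>\<^sup>2) * (total_flow_time I y + energy P I y)"
proof -
  define n where "n t = ennreal (real (card (unsatisfied I r t)))" for t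
  have [measurable]: "n \<in> borel_measurable borel" unfolding n_def by (rule borel_of_unsatisfied)
  have flow: "total_flow_time I r = (\<integral>\<^sup>+ t. n t \<partial>lborel)"
    unfolding n_def by (rule total_flow_time_eq[OF I])
  have "algorithm_energy P I r \<le> (\<integral>\<^sup>+ t. n t \<partial>lborel)"
    unfolding algorithm_energy_def n_def power_speed(2)[OF P of_nat_0_le_iff]
    by (intro nn_integral_mono) (auto simp: indicator_def)
  then have "total_flow_time I r + algorithm_energy P I r \<le> 2 * (\<integral>\<^sup>+ t. n t \<partial>lborel)"
    unfolding flow mult_2 by (intro add_left_mono)
  also have "(\<integral>\<^sup>+ t. n t \<partial>lborel) = emeasure (density lborel n) (\<Union>k::nat. {..real k})"
    by (simp add: emeasure_density UN_atMost_UNIV real_arch_simple)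
  also have "\<dots> = (SUP k::nat. emeasure (density lborel n) {..real k})"
    by (intro SUP_emeasure_incseq[symmetric]) (auto simp: incseq_def)
  also have "\<dots> = (SUP k::nat. \<integral>\<^sup>+ t\<in>{..real k}. n t \<partial>lborel)"
    by (simp add: emeasure_density)
  also have "2 * \<dots> = (SUP k::nat. 2 * (\<integral>\<^sup>+ t\<in>{..real k}. n t \<partial>lborel))"
    by (rule SUP_mult_left_ennreal)
  also have "\<dots> \<le> ennreal (2 / \<epsilon>\<^sup>2) * (total_flow_time I y + energy P I y)"
    unfolding n_def by (intro SUP_least flow_plus_energy_until[OF P I \<epsilon> r y])
  finally show ?thesis .
qed

lemma algorithm_competitive:
  assumes P: "power_function P" and I: "broadcast_instance I" and \<epsilon>: "0 < \<epsilon>" "\<epsilon> \<le> 1 / 6"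
    and r: "algorithm_schedule P (1 + 6 * \<epsilon>) \<epsilon> I r"
  shows "total_flow_time I r + algorithm_energy P I r \<le> ennreal (2 / \<epsilon>\<^sup>2) * opt_cost P I"
proof -
  have "(total_flow_time I r + algorithm_energy P I r) / ennreal (2 / \<epsilon>\<^sup>2) \<le> opt_cost P I"
    unfolding opt_cost_def
    using algorithm_flow_plus_energy_le[OF P I \<epsilon> r] \<epsilon>
    by (intro INF_greatest divide_le_posI_ennreal) auto
  from mult_left_mono[OF this, of "ennreal (2 / \<epsilon>\<^sup>2)"] show ?thesis
    using \<epsilon> by (simp add: ennreal_times_divide mult_divide_eq_ennreal mult.commute)
qed


section \<open>Existence of the algorithm's schedule\<close>

definition page_rate ::
  "(real \<Rightarrow> real) \<Rightarrow> real \<Rightarrow> real \<Rightarrow> 'p instance_data \<Rightarrow> nat set \<Rightarrow> 'p \<Rightarrow> real" where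
  "page_rate P \<alpha> \<beta> I N p = (\<Sum>j\<in>{j \<in> N. req_page I j = p}. contribution P \<alpha> \<beta> N j)"

definition algorithm_schedule_until ::
  "(real \<Rightarrow> real) \<Rightarrow> real \<Rightarrow> real \<Rightarrow> 'p instance_data \<Rightarrow> real \<Rightarrow> ('p \<Rightarrow> real \<Rightarrow> real) \<Rightarrow> bool" where
  "algorithm_schedule_until P \<alpha> \<beta> I T r \<longleftrightarrow> schedule I r \<and>
     (\<forall>t\<ge>0. t < T \<longrightarrow> (\<forall>p\<in>pages I. r p t = page_rate P \<alpha> \<beta> I (unsatisfied I r t) p))"

text \<open>The termination measure. A request that has not arrived counts twice, for its arrival
  and for its satisfaction, as \<open>satisfied_by\<close> is false before the arrival.\<close>

definition pending_events :: "'p instance_data \<Rightarrow> ('p \<Rightarrow> real \<Rightarrow> real) \<Rightarrow> real \<Rightarrow> nat" where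
  "pending_events I r T = card {j. j < length (requests I) \<and> T < arrival I j} +
     card {j. j < length (requests I) \<and> \<not> satisfied_by I r j T}"

lemma amount_broadcast_switch_before:
  assumes "t \<le> T"
  shows "amount_broadcast (\<lambda>p t. if t < T then r p t else c p) p a t = amount_broadcast r p a t"
  unfolding amount_broadcast_def
proof (rule nn_integral_cong_AE, rule AE_mp[OF AE_lborel_singleton[of T]], rule AE_I2, rule impI)
  fix x :: real assume "x \<noteq> T"
  then show "ennreal (if x < T then r p x else c p) * indicator {a..t} x = ennreal (r p x) * indicator {a..t} x"
    using assms by (auto simp: indicator_def)
qed

lemma amount_broadcast_switch_after:
  assumes "a \<le> T" "T \<le> t" "0 \<le> c p" and meas: "r p \<in> borel_measurable borel"
  shows "amount_broadcast (\<lambda>p t. if t < T then r p t else c p) p a t =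
    amount_broadcast r p a T + ennreal (c p * (t - T))"
proof -
  let ?f = "\<lambda>p t. if t < T then r p t else c p"
  have [measurable]: "?f p \<in> borel_measurable borel" using meas by measurable
  have "amount_broadcast ?f p a t =
      (\<integral>\<^sup>+ x. ennreal (?f p x) * indicator {a..T} x + ennreal (c p) * indicator {T<..t} x \<partial>lborel)"
    unfolding amount_broadcast_def using assms(1,2)
    by (intro nn_integral_cong) (auto simp: indicator_def)
  also have "\<dots> = amount_broadcast ?f p a T + (\<integral>\<^sup>+ x. ennreal (c p) * indicator {T<..t} x \<partial>lborel)"
    unfolding amount_broadcast_def by (rule nn_integral_add) measurable
  also have "(\<integral>\<^sup>+ x. ennreal (c p) * indicator {T<..t} x \<partial>lborel) = ennreal (c p * (t - T))"
    using assms by (simp add: nn_integral_cmult_indicator ennreal_mult)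
  also have "amount_broadcast ?f p a T = amount_broadcast r p a T"
    by (rule amount_broadcast_switch_before) simp
  finally show ?thesis .
qed

lemma card_less_witness:
  assumes "finite B" "i \<in> B" "i \<notin> A" "A \<subseteq> B"
  shows "card A < card B"
  using assms by (intro psubset_card_mono) auto

lemma extend_to_next_event:
  assumes P: "power_function P" and I: "broadcast_instance I" and \<alpha>: "0 \<le> \<alpha>" and \<beta>: "0 \<le> \<beta>"
    and T: "0 \<le> T" and r: "algorithm_schedule_until P \<alpha> \<beta> I T r"
  shows "(\<exists>r'. algorithm_schedule P \<alpha> \<beta> I r') \<or>
    (\<exists>T' r'. 0 \<le> T' \<and> algorithm_schedule_until P \<alpha> \<beta> I T' r' \<and> pending_events I r' T' < pending_events I r T)"
proof -
  define m where "m = length (requests I)"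
  define N where "N = unsatisfied I r T"
  define c where "c = page_rate P \<alpha> \<beta> I N"
  define r' where "r' = (\<lambda>p t. if t < T then r p t else c p)"
  define D where "D j = {t. T < t \<and> (T < arrival I j \<and> arrival I j \<le> t \<or> j \<in> N \<and> satisfied_by I r' j t)}" for j
  have r_meas: "r p \<in> borel_measurable borel" "0 \<le> r p t" if "p \<in> pages I" for p t
    using r that by (auto simp: algorithm_schedule_until_def schedule_def)
  have c0: "0 \<le> c p" for p
    unfolding c_def page_rate_def by (intro sum_nonneg contribution_nonneg[OF P \<alpha> \<beta>])
  have sch: "schedule I r'"
    unfolding schedule_def r'_def
  proof (intro ballI conjI allI)
    fix p t assume "p \<in> pages I"
    note [measurable] = r_meas(1)[OF this]
    show "(\<lambda>t. if t < T then r p t else c p) \<in> borel_measurable borel" by measurable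
    show "0 \<le> (if t < T then r p t else c p)" using r_meas(2)[OF \<open>p \<in> pages I\<close>] c0 by simp
  qed
  have sat: "satisfied_by I r' j t \<longleftrightarrow> satisfied_by I r j t" if "t \<le> T" for j t
    unfolding satisfied_by_def r'_def amount_broadcast_switch_before[OF that] ..
  have unsat: "unsatisfied I r' t = unsatisfied I r t" if "t \<le> T" for t
    unfolding unsatisfied_def using sat[OF that] by simp
  have event_set: "\<exists>e>T. D j = {e..}" if j: "j < m" and ne: "D j \<noteq> {}" for j
  proof (cases "j \<in> N")
    case False
    then have "D j = {arrival I j..}" "T < arrival I j" using ne by (auto simp: D_def)
    then show ?thesis by blast
  next
    case True
    let ?p = "req_page I j"
    let ?a = "arrival I j" and ?\<sigma> = "page_size I ?p"
    have p: "?p \<in> pages I" using req_page_in_pages[OF I] j by (simp add: m_def)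
    have \<sigma>: "0 < ?\<sigma>" using I p by (simp add: broadcast_instance_def)
    have a: "?a \<le> T" "\<not> satisfied_by I r j T" using True by (auto simp: N_def unsatisfied_def)
    then have "amount_broadcast r ?p ?a T < ennreal ?\<sigma>" by (simp add: satisfied_by_def)
    then obtain z where z: "amount_broadcast r ?p ?a T = ennreal z" "0 \<le> z" "z < ?\<sigma>"
      by (cases "amount_broadcast r ?p ?a T") (auto simp: ennreal_less_iff)
    have D: "D j = {t. T < t \<and> ?\<sigma> \<le> z + c ?p * (t - T)}"
    proof -
      have "satisfied_by I r' j t \<longleftrightarrow> ?\<sigma> \<le> z + c ?p * (t - T)" if "T < t" for t
      proof -
        have "amount_broadcast r' ?p ?a t = ennreal z + ennreal (c ?p * (t - T))"
          unfolding r'_def z(1)[symmetric] using a that c0 r_meas(1)[OF p]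
          by (intro amount_broadcast_switch_after) auto
        also have "\<dots> = ennreal (z + c ?p * (t - T))" using z c0 that by simp
        finally show ?thesis
          using a that z c0[of ?p] by (simp add: satisfied_by_def ennreal_le_iff del: ennreal_plus)
      qed
      moreover have "D j = {t. T < t \<and> satisfied_by I r' j t}"
        using True a by (simp add: D_def)
      ultimately show ?thesis by blast
    qed
    obtain t where "t \<in> D j" using ne by blast
    then have "?\<sigma> \<le> z + c ?p * (t - T)" unfolding D by simp
    then have "c ?p \<noteq> 0" using z(3) by fastforce
    then have c: "0 < c ?p" using c0[of ?p] by simp
    have "D j = {T + (?\<sigma> - z) / c ?p..}"
      unfolding D
    proof (intro equalityI subsetI; clarsimp)
      fix t assume "T < t" "?\<sigma> \<le> z + c ?p * (t - T)"
      then show "T + (?\<sigma> - z) / c ?p \<le> t" using c by (simp add: field_simps)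
    next
      fix t assume t: "T + (?\<sigma> - z) / c ?p \<le> t"
      moreover have "0 < (?\<sigma> - z) / c ?p" using c z by simp
      ultimately have "T < t" by linarith
      with t show "T < t \<and> ?\<sigma> \<le> z + c ?p * (t - T)" using c by (simp add: field_simps)
    qed
    moreover have "T < T + (?\<sigma> - z) / c ?p" using c z by simp
    ultimately show ?thesis by blast
  qed
  have quiet: "unsatisfied I r' t = N" if t: "T \<le> t" and no: "\<And>j. j < m \<Longrightarrow> t \<notin> D j" for t
  proof (intro equalityI subsetI)
    fix j assume j: "j \<in> unsatisfied I r' t"
    then have "j < m" "arrival I j \<le> t" by (auto simp: unsatisfied_def m_def)
    then have "arrival I j \<le> T" using no[of j] t by (auto simp: D_def)
    then show "j \<in> N" using unsatisfied_antimono[OF j _ t] unsat[of T] by (simp add: N_def)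
  next
    fix j assume j: "j \<in> N"
    then have "j < m" "arrival I j \<le> T" "\<not> satisfied_by I r' j T"
      using sat[of T j] by (auto simp: N_def unsatisfied_def m_def)
    then show "j \<in> unsatisfied I r' t"
      using no[of j] t j by (cases "t = T") (auto simp: D_def unsatisfied_def m_def)
  qed
  have follows: "r' p t = page_rate P \<alpha> \<beta> I (unsatisfied I r' t) p"
    if "0 \<le> t" "p \<in> pages I" and no: "\<And>j. T \<le> t \<Longrightarrow> j < m \<Longrightarrow> t \<notin> D j" for t p
  proof (cases "t < T")
    case True
    then show ?thesis using r that unsat[of t] by (simp add: algorithm_schedule_until_def r'_def)
  next
    case False
    then show ?thesis using quiet[of t] no by (simp add: r'_def c_def)
  qed
  show ?thesis
  proof (cases "\<forall>j<m. D j = {}")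
    case True
    then have "r' p t = page_rate P \<alpha> \<beta> I (unsatisfied I r' t) p" if "0 \<le> t" "p \<in> pages I" for t p
      using that by (intro follows) auto
    then have "algorithm_schedule P \<alpha> \<beta> I r'"
      unfolding algorithm_schedule_def page_rate_def using sch by blast
    then show ?thesis by blast
  next
    case False
    define K where "K = {j. j < m \<and> D j \<noteq> {}}"
    have "\<forall>j\<in>K. \<exists>e>T. D j = {e..}" using event_set by (auto simp: K_def)
    then obtain e where e: "\<And>j. j \<in> K \<Longrightarrow> T < e j" "\<And>j. j \<in> K \<Longrightarrow> D j = {e j..}"
      by metis
    have K: "finite K" "K \<noteq> {}" using False by (auto simp: K_def)
    \<comment> \<open>The earliest event. No \<open>D j\<close> meets the times before
      \<open>T'\<close>, while some event has happened at \<open>T'\<close>.\<close>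
    define T' where "T' = Min (e ` K)"
    have "T' \<in> e ` K" unfolding T'_def using K by (intro Min_in) auto
    then obtain i where i: "i \<in> K" "T' = e i" by auto
    have TT': "T < T'" using i e by simp
    have "i < m" using i(1) by (simp add: K_def)
    have "t \<notin> D j" if "t < T'" "j < m" for t j
    proof (cases "j \<in> K")
      case True
      then have "T' \<le> e j" unfolding T'_def using K by simp
      then show ?thesis using e(2)[OF True] that by simp
    qed (use that in \<open>simp add: K_def\<close>)
    then have "r' p t = page_rate P \<alpha> \<beta> I (unsatisfied I r' t) p"
      if "0 \<le> t" "t < T'" "p \<in> pages I" for t p
      using that by (intro follows) auto
    then have until: "algorithm_schedule_until P \<alpha> \<beta> I T' r'"
      unfolding algorithm_schedule_until_def using sch by blast
    have "T' \<in> D i" using e(2)[OF i(1)] i by simp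
    then consider "T < arrival I i" "arrival I i \<le> T'" | "i \<in> N" "satisfied_by I r' i T'"
      by (auto simp: D_def)
    moreover have still: "satisfied_by I r' j T'" if "satisfied_by I r j T" for j
      using satisfied_by_mono[of I r' j T T'] sat[of T j] that TT' by simp
    ultimately have "pending_events I r' T' < pending_events I r T"
    proof cases
      case 1
      have "card {j. j < m \<and> T' < arrival I j} < card {j. j < m \<and> T < arrival I j}"
        by (rule card_less_witness[of _ i]) (use 1 TT' \<open>i < m\<close> in auto)
      moreover have "card {j. j < m \<and> \<not> satisfied_by I r' j T'} \<le> card {j. j < m \<and> \<not> satisfied_by I r j T}"
        using still by (intro card_mono) auto
      ultimately show ?thesis unfolding pending_events_def m_def by linarith
    next
      case 2
      have "\<not> satisfied_by I r i T" using 2 by (simp add: N_def unsatisfied_def)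
      then have "card {j. j < m \<and> \<not> satisfied_by I r' j T'} < card {j. j < m \<and> \<not> satisfied_by I r j T}"
        by (intro card_less_witness[of _ i]) (use 2 still \<open>i < m\<close> in auto)
      moreover have "card {j. j < m \<and> T' < arrival I j} \<le> card {j. j < m \<and> T < arrival I j}"
        using TT' by (intro card_mono) auto
      ultimately show ?thesis unfolding pending_events_def m_def by linarith
    qed
    then show ?thesis using until T TT' by (intro disjI2 exI[of _ T'] exI[of _ r']) auto
  qed
qed

text \<open>Induction on the pending events, started at time 0, where the zero schedule satisfies
  the requirement vacuously.\<close>

lemma algorithm_schedule_exists:
  assumes P: "power_function P" and I: "broadcast_instance I" and \<alpha>: "0 \<le> \<alpha>" and \<beta>: "0 \<le> \<beta>"
  shows "\<exists>r. algorithm_schedule P \<alpha> \<beta> I r"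
proof -
  have "\<exists>r'. algorithm_schedule P \<alpha> \<beta> I r'"
    if "0 \<le> T" "algorithm_schedule_until P \<alpha> \<beta> I T r" for T r
    using that
  proof (induction "pending_events I r T" arbitrary: T r rule: less_induct)
    case less
    from extend_to_next_event[OF P I \<alpha> \<beta> less.prems] show ?case
      using less.hyps by blast
  qed
  moreover have "algorithm_schedule_until P \<alpha> \<beta> I 0 (\<lambda>_ _. 0)"
    by (simp add: algorithm_schedule_until_def schedule_def)
  ultimately show ?thesis by (meson order_refl)
qed

text \<open>The existence part keeps the bound from being vacuous; the bound holds for every
  schedule that follows the rule.\<close>

theorem theorem4:
  fixes P :: "real \<Rightarrow> real" and I :: "'p instance_data" and \<epsilon> :: real
  assumes "power_function P"
    and "broadcast_instance I"
    and "0 < \<epsilon>" and "\<epsilon> \<le> 1 / 6"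
  shows "(\<exists>r. algorithm_schedule P (1 + 6 * \<epsilon>) \<epsilon> I r) \<and>
    (\<forall>r. algorithm_schedule P (1 + 6 * \<epsilon>) \<epsilon> I r \<longrightarrow>
       total_flow_time I r + algorithm_energy P I r \<le> ennreal (2 / \<epsilon>\<^sup>2) * opt_cost P I)"
  using algorithm_schedule_exists[OF assms(1,2), of "1 + 6 * \<epsilon>" \<epsilon>]
    algorithm_competitive[OF assms] assms(3)
  by simp

end
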